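(* Let $N\geq 1$ be an integer and let $k,l\in\mathbb{R}$ satisfy $k+N-1>0$, $l+N>0$ and $l+1\leq k$. Then $C_{k,l,N}=C_{k,l,N}^{rad}$. Moreover, if $l+1<k$ and $\mathcal{R}_{k,l,N}(M)=C_{k,l,N}^{rad}$ for some measurable set $M\subset\mathbb{R}^N$ with $0<\mu_l(M)<+\infty$, then $M=B_R$ (up to a Lebesgue null set) for some $R>0$.
   Context: $B_R$ is the open ball of radius $R$ centered at the origin of $\mathbb{R}^N$, $\omega_N$ is the Lebesgue measure of $B_1$, and $d\mu_l(x)=|x|^l\,dx$. The $\mu_k$-perimeter of a measurable set $M\subset\mathbb{R}^N$ is $$P_{\mu_k}(M):=\sup\left\{\int_M \mathrm{div}(|x|^k\mathbf{v})\,dx:\ \mathbf{v}\in C_0^1(\mathbb{R}^N,\mathbb{R}^N),\ |\mathbf{v}|\leq 1 \text{ in } M\right\}.$$ For measurable $M$ with $0<\mu_l(M)<+\infty$ set $$\mathcal{R}_{k,l,N}(M):=\frac{P_{\mu_k}(M)}{(\mu_l(M))^{(k+N-1)/(l+N)}},$$ and $C_{k,l,N}:=\inf\{\mathcal{R}_{k,l,N}(M): M \text{ measurable},\ 0<\mu_l(M)<+\infty\}$. Further $$C_{k,l,N}^{rad}:=(N\omega_N)^{(l-k+1)/(l+N)}(l+N)^{(k+N-1)/(l+N)}=\mathcal{R}_{k,l,N}(B_1).$$ *)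

theory Defs
  imports "HOL-Analysis.Analysis"
begin

text \<open>
  The ambient space is \<open>real ^ 'n\<close> with \<open>N = CARD('n)\<close>. Since \<open>0 powr a = 0\<close> for every \<open>a\<close>, the
  weight \<open>norm x powr a\<close> has a conventional value at the origin, which is a Lebesgue null set.
\<close>

definition mu :: "real \<Rightarrow> (real ^ 'n) measure" where
  "mu l = density lebesgue (\<lambda>x. ennreal (norm x powr l))"

text \<open>Continuously differentiable vector fields with compact support.\<close>

definition C1_compact_support :: "(real ^ 'n \<Rightarrow> real ^ 'n) \<Rightarrow> bool" where
  "C1_compact_support v \<longleftrightarrow>
     (\<exists>v'. (\<forall>x. (v has_derivative blinfun_apply (v' x)) (at x)) \<and> continuous_on UNIV v')
     \<and> compact (closure {x. v x \<noteq> 0})"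

definition divergence :: "(real ^ 'n \<Rightarrow> real ^ 'n) \<Rightarrow> real ^ 'n \<Rightarrow> real" where
  "divergence F x = (\<Sum>i\<in>UNIV. frechet_derivative F (at x) (axis i 1) $ i)"

text \<open>
  The divergence below is the classical pointwise one. It can fail to exist only at the origin, and
  for \<open>k + N - 1 > 0\<close> it is Lebesgue integrable, being
  \<open>O(norm x powr (k - 1))\<close> near \<open>0\<close> and compactly supported. The supremum may be \<open>\<infinity>\<close>.
\<close>

definition perimeter :: "real \<Rightarrow> (real ^ 'n) set \<Rightarrow> ereal" where
  "perimeter k M =
     (SUP v \<in> {v. C1_compact_support v \<and> (\<forall>x\<in>M. norm (v x) \<le> 1)}.
        ereal (LINT x:M|lebesgue. divergence (\<lambda>y. (norm y powr k) *\<^sub>R v y) x))"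

text \<open>The measurable sets of positive finite \<open>\<mu>\<^sub>l\<close>-measure.\<close>

definition admissible :: "real \<Rightarrow> (real ^ 'n) set \<Rightarrow> bool" where
  "admissible l M \<longleftrightarrow> M \<in> sets lebesgue \<and> 0 < emeasure (mu l) M \<and> emeasure (mu l) M < \<infinity>"

definition isoperimetric_ratio :: "real \<Rightarrow> real \<Rightarrow> (real ^ 'n) set \<Rightarrow> ereal" where
  "isoperimetric_ratio k l M =
     perimeter k M /
     ereal (measure (mu l) M powr ((k + real CARD('n) - 1) / (l + real CARD('n))))"

text \<open>The dimension enters the constants through the type argument.\<close>

definition iso_const :: "'n::finite itself \<Rightarrow> real \<Rightarrow> real \<Rightarrow> ereal" where
  "iso_const _ k l = (INF M \<in> {M :: (real ^ 'n) set. admissible l M}. isoperimetric_ratio k l M)"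

definition omega :: "'n::finite itself \<Rightarrow> real" where
  "omega _ = measure lebesgue (ball (0 :: real ^ 'n) 1)"

definition iso_const_rad :: "'n::finite itself \<Rightarrow> real \<Rightarrow> real \<Rightarrow> real" where
  "iso_const_rad n k l =
     (real CARD('n) * omega n) powr ((l - k + 1) / (l + real CARD('n)))
     * (l + real CARD('n)) powr ((k + real CARD('n) - 1) / (l + real CARD('n)))"

end

theory Submission imports Defs begin

text \<open>
  Testing the perimeter with truncations of the radial field \<open>x / |x|\<close> gives
  \<open>(k + N - 1) \<mu>\<^bsub>k-1\<^esub>(M) \<le> P\<^bsub>\<mu>k\<^esub>(M)\<close>, because
  \<open>div (|x|\<^sup>k x / |x|) = (k + N - 1) |x|\<^bsup>k-1\<^esup>\<close>. As \<open>k - 1 \<ge> l\<close>, the bathtub principle shows that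
  among all sets of given \<open>\<mu>\<^sub>l\<close>-measure the centred ball minimises \<open>\<mu>\<^bsub>k-1\<^esub>\<close>, uniquely up to null
  sets when \<open>k - 1 > l\<close>. Conversely \<open>P\<^bsub>\<mu>k\<^esub>(B\<^sub>1) \<le> N \<omega>\<^sub>N\<close>: multiply the field by a smooth radial
  cutoff of the ball, use that the divergence of a compactly supported field has integral zero, and
  integrate the gradient of the cutoff in polar coordinates.
\<close>

text \<open>\<open>M\<close> is only measurable: it may be unbounded, its perimeter and its
  \<open>mu (k - 1)\<close>-measure may be infinite, and no regularity of its boundary is available.
  Lower bounds must come from explicit admissible fields, and \<open>x / |x|\<close> is not one: it
  is discontinuous at the origin and lacks compact support. The only integrability at hand is that
  of \<open>|x|^l\<close> on \<open>M\<close>, and this dictates how fast the approximating fields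
  must decay. For the ball the obstacle is the origin, where the weight need not be differentiable
  and blows up when \<open>k < 0\<close>; hence the weight is smoothed along with the indicator.
  Radial factors are functions of \<open>s = |x|^2\<close> instead of \<open>|x|\<close>, since
  \<open>s\<close> is smooth at the origin. Minimisers are never constructed by compactness, and the
  perimeter is never rearranged: equality of perimeters passes directly to equality in the bathtub
  comparison.\<close>

section \<open>Calculus of radial factors and divergences\<close>

text \<open>Squaring removes the kink of the positive part, so cutoffs built from it are
  continuously differentiable while vanishing beyond a given radius.\<close>

lemma has_real_derivative_pos_part_square:
  "((\<lambda>t. (max 0 t)\<^sup>2) has_real_derivative 2 * max 0 t) (at t)"
proof (cases "t = 0")
  case True
  have "((\<lambda>h. ((max 0 (0 + h))\<^sup>2 - (max 0 0)\<^sup>2) / h) \<longlongrightarrow> 0) (at (0::real))"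
  proof (rule Lim_null_comparison)
    show "\<forall>\<^sub>F h in at (0::real). norm (((max 0 (0 + h))\<^sup>2 - (max 0 0)\<^sup>2) / h) \<le> \<bar>h\<bar>"
      by (rule always_eventually) (auto simp: max_def power2_eq_square)
    show "((\<lambda>h. \<bar>h\<bar>) \<longlongrightarrow> 0) (at (0::real))"
      by (rule tendsto_eq_intros refl | simp)+
  qed
  then show ?thesis using True by (simp add: DERIV_def)
next
  case False
  then consider "t > 0" | "t < 0" by linarith
  then show ?thesis
  proof cases
    case 1
    have "((\<lambda>t. t\<^sup>2) has_real_derivative 2 * max 0 t) (at t)"
      by (rule derivative_eq_intros refl | use 1 in simp)+
    then show ?thesis
      by (rule has_field_derivative_transform_within_open[where S="{0<..}"]) (use 1 in auto)
  next
    case 2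
    have "((\<lambda>t. 0) has_real_derivative 2 * max 0 t) (at t)"
      using 2 by simp
    then show ?thesis
      by (rule has_field_derivative_transform_within_open[where S="{..<0}"]) (use 2 in auto)
  qed
qed

lemma has_derivative_radial_scale:
  fixes v :: "'a::real_inner \<Rightarrow> 'b::real_normed_vector"
  assumes "(W has_real_derivative W') (at (x \<bullet> x))" and "(v has_derivative v') (at x)"
  shows "((\<lambda>y. W (y \<bullet> y) *\<^sub>R v y) has_derivative
           (\<lambda>h. W (x \<bullet> x) *\<^sub>R v' h + (2 * W' * (x \<bullet> h)) *\<^sub>R v x)) (at x)"
proof -
  have "((\<lambda>y. y \<bullet> y) has_derivative (\<lambda>h. 2 * (x \<bullet> h))) (at x)"
    by (auto intro!: derivative_eq_intros simp: inner_commute)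
  from has_derivative_compose[OF this, of W "\<lambda>t. W' * t"] assms(1)
  have "((\<lambda>y. W (y \<bullet> y)) has_derivative (\<lambda>h. W' * (2 * (x \<bullet> h)))) (at x)"
    by (simp add: has_field_derivative_def)
  from has_derivative_scaleR[OF this assms(2)] show ?thesis
    by (simp add: mult_ac)
qed

lemma divergence_eq_sum:
  assumes "(F has_derivative F') (at x)"
  shows "divergence F x = (\<Sum>i\<in>UNIV. F' (axis i 1) $ i)"
  unfolding divergence_def using frechet_derivative_at[OF assms] by simp

lemma divergence_radial_scale:
  fixes v :: "real ^ 'n \<Rightarrow> real ^ 'n"
  assumes "(W has_real_derivative W') (at (x \<bullet> x))" and "(v has_derivative v') (at x)"
  shows "divergence (\<lambda>y. W (y \<bullet> y) *\<^sub>R v y) x = W (x \<bullet> x) * divergence v x + 2 * W' * (x \<bullet> v x)"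
proof -
  have "divergence (\<lambda>y. W (y \<bullet> y) *\<^sub>R v y) x
      = (\<Sum>i\<in>UNIV. W (x \<bullet> x) * (v' (axis i 1) $ i) + 2 * W' * (x $ i * v x $ i))"
    by (simp add: divergence_eq_sum[OF has_derivative_radial_scale[OF assms]] inner_axis mult_ac)
  also have "\<dots> = W (x \<bullet> x) * divergence v x + 2 * W' * (x \<bullet> v x)"
    by (simp add: sum.distrib sum_distrib_left divergence_eq_sum[OF assms(2)] inner_vec_def)
  finally show ?thesis .
qed

lemma divergence_ident: "divergence (\<lambda>y::real ^ 'n. y) x = CARD('n)"
  by (simp add: divergence_eq_sum[OF has_derivative_ident])

lemma norm_powr_eq: "norm x powr k = (x \<bullet> x) powr (k / 2)"
  by (simp add: norm_eq_sqrt_inner powr_half_sqrt[symmetric] powr_powr)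

section \<open>Vanishing total divergence of compactly supported fields\<close>

lemma integrable_compact_support:
  fixes f :: "'a::euclidean_space \<Rightarrow> real"
  assumes cont: "continuous_on UNIV f" and supp: "\<And>x. x \<notin> cball 0 R \<Longrightarrow> f x = 0"
  shows "integrable lborel f"
proof -
  have "integrable lborel (\<lambda>x. indicator (cball 0 R) x *\<^sub>R f x)"
    using borel_integrable_compact[of "cball 0 R" f] continuous_on_subset[OF cont]
    by (auto simp: set_integrable_def)
  also have "(\<lambda>x. indicator (cball 0 R) x *\<^sub>R f x) = f"
    using supp by (auto simp: indicator_def fun_eq_iff)
  finally show ?thesis .
qed

text \<open>
  By translation invariance the difference quotients of \<open>f\<close> have integral zero; they converge
  boundedly to the directional derivative.
\<close>
lemma integral_directional_derivative_eq_0: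
  fixes f :: "'a::euclidean_space \<Rightarrow> real"
  assumes der: "\<And>x. (f has_derivative f' x) (at x)"
    and cont: "continuous_on UNIV (\<lambda>x. f' x e)"
    and supp: "\<And>x. x \<notin> cball 0 R \<Longrightarrow> f x = 0"
  shows "(\<integral>x. f' x e \<partial>lborel) = 0" "integrable lborel (\<lambda>x. f' x e)"
proof -
  have f'0: "f' x e = 0" if "x \<notin> cball 0 R" for x
  proof -
    have "(f has_derivative (\<lambda>_. 0)) (at x)"
      by (rule has_derivative_transform_within_open[of "\<lambda>_. 0" _ _ _ "- cball 0 R"])
        (use that supp in auto)
    with der[of x] have "f' x = (\<lambda>_. 0)"
      by (rule has_derivative_unique)
    then show ?thesis by simp
  qed
  have "compact ((\<lambda>x. f' x e) ` cball 0 R)"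
    by (intro compact_continuous_image continuous_on_subset[OF cont]) auto
  then obtain B0 where B0: "\<And>x. x \<in> cball 0 R \<Longrightarrow> \<bar>f' x e\<bar> \<le> B0"
    by (force dest!: compact_imp_bounded simp: bounded_iff)
  define B where "B = max 0 B0"
  have B: "\<bar>f' x e\<bar> \<le> B" for x
    using B0[of x] f'0[of x] by (cases "x \<in> cball 0 R") (auto simp: B_def)
  have fc: "continuous_on UNIV f"
    using der by (meson differentiableI differentiable_imp_continuous_within continuous_at_imp_continuous_on)
  have fm [measurable]: "f \<in> borel_measurable borel"
    using fc by (rule borel_measurable_continuous_onI)
  have f'm [measurable]: "(\<lambda>x. f' x e) \<in> borel_measurable borel"
    using cont by (rule borel_measurable_continuous_onI)
  have fint: "integrable lborel f"
    using fc supp by (rule integrable_compact_support)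
  define q where "q = (\<lambda>n (x::'a). (f (x + (1 / Suc n) *\<^sub>R e) - f x) * Suc n)"
  \<comment> \<open>Shifts have length at most \<open>norm e\<close>, so every quotient is supported
    in this enlarged ball; there the derivative bound \<open>B\<close> majorises it.\<close>
  define g where "g = (\<lambda>x::'a. B * indicator (cball 0 (R + norm e)) x :: real)"
  have qm: "q n \<in> borel_measurable lborel" for n
    unfolding q_def by simp
  have q0: "(\<integral>x. q n x \<partial>lborel) = 0" for n
  proof -
    let ?T = "\<lambda>x. (1 / Suc n) *\<^sub>R e + x"
    have eq: "distr lborel borel ?T = lborel" by (rule lborel_distr_plus)
    have i1: "integrable lborel (\<lambda>x. f (?T x))"
      using fint eq by (subst (asm) eq[symmetric], subst (asm) integrable_distr_eq) auto
    have i2: "(\<integral>x. f (?T x) \<partial>lborel) = integral\<^sup>L lborel f"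
      by (subst (2) eq[symmetric], subst integral_distr) auto
    show ?thesis unfolding q_def
      using i1 i2 fint by (simp add: add.commute)
  qed
  have qlim: "(\<lambda>n. q n x) \<longlonglongrightarrow> f' x e" for x
  proof -
    have "((\<lambda>t. f (x + t *\<^sub>R e)) has_derivative (\<lambda>t. f' x (t *\<^sub>R e))) (at 0)"
      by (rule has_derivative_compose[of "\<lambda>t. x + t *\<^sub>R e", where g=f and g'="f' x"])
        (auto intro!: derivative_eq_intros der)
    also have "(\<lambda>t. f' x (t *\<^sub>R e)) = (\<lambda>t. t * f' x e)"
      using has_derivative_linear[OF der[of x]] by (simp add: linear_cmul)
    finally have "((\<lambda>t. f (x + t *\<^sub>R e)) has_real_derivative f' x e) (at 0)"
      by (simp add: has_field_derivative_def mult_commute_abs)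
    then have "((\<lambda>h. (f (x + h *\<^sub>R e) - f x) / h) \<longlongrightarrow> f' x e) (at 0)"
      by (simp add: DERIV_def)
    then have "((\<lambda>n. (f (x + (1 / Suc n) *\<^sub>R e) - f x) / (1 / Suc n)) \<longlongrightarrow> f' x e) sequentially"
      by (rule filterlim_compose)
        (use LIMSEQ_inverse_real_of_nat in \<open>auto simp: filterlim_at inverse_eq_divide\<close>)
    then show ?thesis by (simp add: q_def)
  qed
  have qbd: "norm (q n x) \<le> g x" for n x
  proof (cases "x \<in> cball 0 (R + norm e)")
    case True
    \<comment> \<open>Mean value theorem along the segment from \<open>x\<close> to the shifted
      point: the quotient equals a directional derivative at an intermediate point, so
      \<open>B\<close> bounds it uniformly in \<open>n\<close>.\<close>
    have "\<exists>t. 0 < t \<and> t < 1 \<and> f (x + 1 *\<^sub>R ((1 / Suc n) *\<^sub>R e)) - f (x + 0 *\<^sub>R ((1 / Suc n) *\<^sub>R e))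
        = (1 - 0) * f' (x + t *\<^sub>R ((1 / Suc n) *\<^sub>R e)) ((1 / Suc n) *\<^sub>R e)"
    proof (rule MVT2)
      fix t :: real
      let ?e = "(1 / Suc n) *\<^sub>R e"
      have "((\<lambda>t. f (x + t *\<^sub>R ?e)) has_derivative (\<lambda>s. f' (x + t *\<^sub>R ?e) (s *\<^sub>R ?e))) (at t)"
        by (rule has_derivative_compose[of "\<lambda>t. x + t *\<^sub>R ?e", where g=f])
          (auto intro!: derivative_eq_intros der)
      also have "(\<lambda>s. f' (x + t *\<^sub>R ?e) (s *\<^sub>R ?e)) = (\<lambda>s. s * f' (x + t *\<^sub>R ?e) ?e)"
        using has_derivative_linear[OF der] by (metis linear_cmul real_scaleR_def)
      finally show "((\<lambda>t. f (x + t *\<^sub>R ?e)) has_real_derivative f' (x + t *\<^sub>R ?e) ?e) (at t)"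
        by (simp only: has_field_derivative_def mult_commute_abs)
    qed simp
    then obtain t where "f (x + (1 / Suc n) *\<^sub>R e) - f x = f' (x + t *\<^sub>R ((1 / Suc n) *\<^sub>R e)) ((1 / Suc n) *\<^sub>R e)"
      by auto
    also have "\<dots> = (1 / Suc n) * f' (x + t *\<^sub>R ((1 / Suc n) *\<^sub>R e)) e"
      using has_derivative_linear[OF der] by (metis linear_cmul real_scaleR_def)
    finally have "q n x = f' (x + t *\<^sub>R ((1 / Suc n) *\<^sub>R e)) e"
      by (simp add: q_def)
    with B show ?thesis using True by (simp add: g_def)
  next
    case False
    then have x: "R + norm e < norm x" by simp
    have "norm ((1 / Suc n) *\<^sub>R e) \<le> norm e"
      by (simp add: divide_le_eq mult_le_cancel_left1)
    then have "R < norm (x + (1 / Suc n) *\<^sub>R e)"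
      using x norm_diff_ineq[of x "(1 / Suc n) *\<^sub>R e"] by linarith
    moreover have "R < norm x"
      using x norm_ge_zero[of e] by linarith
    ultimately show ?thesis using False supp by (simp add: q_def g_def)
  qed
  have gint: "integrable lborel g"
    unfolding g_def by (intro integrable_mult_right integrable_real_indicator)
      (auto simp: emeasure_lborel_cball_finite[simplified])
  have "(\<lambda>n. \<integral>x. q n x \<partial>lborel) \<longlonglongrightarrow> (\<integral>x. f' x e \<partial>lborel)"
    by (rule integral_dominated_convergence[where w=g]) (use qm qlim qbd gint in auto)
  then show "(\<integral>x. f' x e \<partial>lborel) = 0"
    by (simp add: q0 LIMSEQ_const_iff)
  show "integrable lborel (\<lambda>x. f' x e)"
    by (rule integrable_dominated_convergence[where w=g and s=q]) (use qm qlim qbd gint in auto)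
qed

lemma integral_divergence_eq_0:
  fixes F :: "real ^ 'n \<Rightarrow> real ^ 'n"
  assumes der: "\<And>x. (F has_derivative F' x) (at x)"
    and cont: "\<And>e. continuous_on UNIV (\<lambda>x. F' x e)"
    and supp: "\<And>x. x \<notin> cball 0 R \<Longrightarrow> F x = 0"
  shows "(\<integral>x. divergence F x \<partial>lborel) = 0" "integrable lborel (divergence F)"
proof -
  have *: "(\<integral>x. F' x (axis i 1) $ i \<partial>lborel) = 0"
    "integrable lborel (\<lambda>x. F' x (axis i 1) $ i)" for i
    by (rule integral_directional_derivative_eq_0[where f="\<lambda>x. F x $ i" and f'="\<lambda>x h. F' x h $ i" and R=R];
        use supp in \<open>auto intro!: bounded_linear.has_derivative[OF bounded_linear_vec_nth] der
          continuous_on_component cont\<close>)+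
  have "divergence F = (\<lambda>x. \<Sum>i\<in>UNIV. F' x (axis i 1) $ i)"
    using divergence_eq_sum[OF der] by blast
  with * show "(\<integral>x. divergence F x \<partial>lborel) = 0" "integrable lborel (divergence F)"
    by (simp_all add: integrable_sum)
qed

section \<open>Polar coordinates and weighted volumes of balls\<close>

lemma emeasure_lborel_norm_le:
  "emeasure lborel {x::real ^ 'n. norm x \<le> r} = ennreal (if r \<ge> 0 then omega TYPE('n) * r ^ CARD('n) else 0)"
proof (cases "r \<ge> 0")
  case True
  have "{x::real ^ 'n. norm x \<le> r} = cball 0 r" by auto
  moreover have "omega TYPE('n) = unit_ball_vol (real CARD('n))"
    using content_ball[of 1 "0::real ^ 'n"] by (simp add: omega_def)
  ultimately show ?thesis using True by (simp add: emeasure_cball)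
next
  case False
  then have "{x::real ^ 'n. norm x \<le> r} = {}"
    by (metis (mono_tags, lifting) Collect_empty_eq norm_ge_zero order_trans)
  then show ?thesis using False by simp
qed

lemma omega_pos: "omega TYPE('n::finite) > 0"
  using content_ball[of 1 "0::real ^ 'n"] by (simp add: omega_def unit_ball_vol_pos)

text \<open>Polar coordinates for radial integrands, without surface measure: a measure on the line
  that is finite on half-lines is determined by them, and the volume \<open>omega * r ^ N\<close> of
  a ball has derivative \<open>N * omega * r ^ (N - 1)\<close>.\<close>

lemma distr_norm_lborel:
  "distr lborel borel (norm :: real ^ 'n \<Rightarrow> real) =
     density lborel (\<lambda>r. ennreal (CARD('n) * omega TYPE('n) * r ^ (CARD('n) - 1)) * indicator {0..} r)"
  (is "?M = ?D")
proof (rule measure_eqI_generator_eq[where E="range atMost" and \<Omega>=UNIV and A="\<lambda>i. {..real i}"])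
  let ?N = "CARD('n)" and ?c = "omega TYPE('n)"
  have M: "emeasure ?M {..r} = ennreal (if r \<ge> 0 then ?c * r ^ ?N else 0)" for r
    by (subst emeasure_distr) (auto simp: vimage_def emeasure_lborel_norm_le)
  show "emeasure ?M X = emeasure ?D X" if "X \<in> range atMost" for X
  proof -
    obtain r where X: "X = {..r}" using \<open>X \<in> range atMost\<close> by auto
    have "emeasure ?D X = (\<integral>\<^sup>+t. ennreal (?N * ?c * t ^ (?N - 1)) * indicator {0..r} t \<partial>lborel)"
      unfolding X by (subst emeasure_density) (auto intro!: nn_integral_cong simp: indicator_def)
    also have "\<dots> = ennreal (if r \<ge> 0 then ?c * r ^ ?N else 0)"
    proof (cases "r \<ge> 0")
      case True
      have "(\<integral>\<^sup>+t. ennreal (?N * ?c * t ^ (?N - 1)) * indicator {0..r} t \<partial>lborel)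
          = ennreal (?c * r ^ ?N - ?c * 0 ^ ?N)"
        by (rule nn_integral_FTC_Icc)
          (use True omega_pos[where 'n='n] in \<open>auto intro!: derivative_eq_intros\<close>)
      then show ?thesis using True by (simp add: zero_power)
    qed auto
    finally show ?thesis unfolding X M by simp
  qed
  show "emeasure ?M {..real i} \<noteq> \<infinity>" for i
    by (simp add: M)
  show "(\<Union>i. {..real i}) = UNIV"
    using real_arch_simple by auto
  show "Int_stable (range (atMost :: real \<Rightarrow> _))"
    by (auto simp: Int_stable_def)
qed (auto simp: borel_eq_atMost)

lemma nn_integral_radial:
  fixes f :: "real \<Rightarrow> ennreal"
  assumes [measurable]: "f \<in> borel_measurable borel"
  shows "(\<integral>\<^sup>+(x::real ^ 'n). f (norm x) \<partial>lborel) =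
    ennreal (CARD('n) * omega TYPE('n)) *
      (\<integral>\<^sup>+r. f r * ennreal (r ^ (CARD('n) - 1)) * indicator {0..} r \<partial>lborel)"
proof -
  have "(\<integral>\<^sup>+(x::real ^ 'n). f (norm x) \<partial>lborel) = (\<integral>\<^sup>+r. f r \<partial>distr lborel borel (norm :: real ^ 'n \<Rightarrow> real))"
    by (subst nn_integral_distr) auto
  also have "\<dots> = (\<integral>\<^sup>+r. ennreal (CARD('n) * omega TYPE('n)) *
      (f r * ennreal (r ^ (CARD('n) - 1)) * indicator {0..} r) \<partial>lborel)"
    unfolding distr_norm_lborel
    by (subst nn_integral_density)
      (use omega_pos[where 'n='n] in \<open>auto intro!: nn_integral_cong simp: indicator_def ennreal_mult mult_ac\<close>)
  also have "\<dots> = ennreal (CARD('n) * omega TYPE('n)) *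
      (\<integral>\<^sup>+r. f r * ennreal (r ^ (CARD('n) - 1)) * indicator {0..} r \<partial>lborel)"
    by (rule nn_integral_cmult) simp
  finally show ?thesis .
qed

lemma emeasure_mu_eq:
  fixes M :: "(real ^ 'n) set"
  assumes "M \<in> sets lebesgue"
  shows "emeasure (mu l) M = (\<integral>\<^sup>+x. ennreal (norm x powr l) * indicator M x \<partial>lebesgue)"
  unfolding mu_def using assms by (subst emeasure_density) (auto intro!: measurable_completion)

text \<open>In polar coordinates the integrand becomes \<open>r powr (l + N - 1)\<close>, which is
  integrable at 0 exactly because \<open>l + N > 0\<close>.\<close>

lemma emeasure_mu_ball:
  fixes l R :: real
  assumes "l + real CARD('n) > 0" "R > 0"
  shows "emeasure (mu l) (ball (0::real ^ 'n) R)
    = ennreal (CARD('n) * omega TYPE('n) * R powr (l + CARD('n)) / (l + CARD('n)))"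
proof -
  let ?N = "CARD('n)"
  have "emeasure (mu l) (ball (0::real ^ 'n) R)
      = (\<integral>\<^sup>+(x::real ^ 'n). ennreal (norm x powr l) * indicator {..<R} (norm x) \<partial>lborel)"
    by (simp add: emeasure_mu_eq nn_integral_completion) (auto intro!: nn_integral_cong simp: indicator_def)
  also have "\<dots> = ennreal (?N * omega TYPE('n)) *
      (\<integral>\<^sup>+r. ennreal (r powr l) * indicator {..<R} r * ennreal (r ^ (?N - 1)) * indicator {0..} r \<partial>lborel)"
    by (subst nn_integral_radial[where f="\<lambda>r. ennreal (r powr l) * indicator {..<R} r"]) auto
  also have "(\<integral>\<^sup>+r. ennreal (r powr l) * indicator {..<R} r * ennreal (r ^ (?N - 1)) * indicator {0..} r \<partial>lborel)
      = (\<integral>\<^sup>+r. ennreal (r powr (l + ?N - 1)) * indicator {0..R} r \<partial>lborel)"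
  proof (rule nn_integral_cong_AE, use AE_lborel_singleton[of 0] AE_lborel_singleton[of R] in eventually_elim)
    fix r :: real assume r: "r \<noteq> 0" "r \<noteq> R"
    have "r powr l * r ^ (?N - 1) = r powr (l + ?N - 1)" if "r > 0"
    proof -
      have "r ^ (?N - 1) = r powr (real ?N - 1)"
        using that by (simp add: powr_realpow[symmetric] of_nat_diff)
      then show ?thesis using that by (simp add: powr_add[symmetric] add_diff_eq)
    qed
    then show "ennreal (r powr l) * indicator {..<R} r * ennreal (r ^ (?N - 1)) * indicator {0..} r
        = ennreal (r powr (l + ?N - 1)) * indicator {0..R} r"
      using r by (auto simp: indicator_def ennreal_mult[symmetric])
  qed
  also have "\<dots> = ennreal (R powr (l + ?N) / (l + ?N))"
    using nn_integral_has_integral_lebesgue'[OF _ has_integral_powr_from_0[of "l + ?N - 1" R]] assms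
    by simp
  finally show ?thesis
    using omega_pos[where 'n='n] assms by (simp add: ennreal_mult[symmetric] mult_ac)
qed

lemma integrable_norm_powr_ball:
  fixes p R :: real
  assumes "p + real CARD('n) > 0" "R > 0"
  shows "integrable lborel (\<lambda>x::real ^ 'n. indicator (ball 0 R) x * norm x powr p)"
proof (rule integrableI_bounded)
  have "(\<integral>\<^sup>+x. ennreal (norm (indicator (ball 0 R) x * norm x powr p)) \<partial>(lborel :: (real ^ 'n) measure))
      = emeasure (mu p) (ball (0::real ^ 'n) R)"
    by (simp add: emeasure_mu_eq nn_integral_completion)
      (auto intro!: nn_integral_cong simp: indicator_def)
  also have "\<dots> < \<infinity>"
    by (simp add: emeasure_mu_ball[OF assms])
  finally show "(\<integral>\<^sup>+x. ennreal (norm (indicator (ball 0 R) x * norm x powr p)) \<partial>(lborel :: (real ^ 'n) measure)) < \<infinity>" .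
qed (auto intro!: borel_measurable_times borel_measurable_indicator)

section \<open>Upper bound for the perimeter of the unit ball\<close>

text \<open>Majorises a regularised weight uniformly in \<open>e\<close>. For \<open>p >= 0\<close>
  the base is at most 2; for \<open>p < 0\<close> the power decreases, so the unregularised weight
  dominates. The sum covers both signs.\<close>

lemma powr_shift_le:
  fixes p s e :: real
  assumes "0 < s" "s \<le> 1" "0 < e" "e \<le> 1"
  shows "(s + e) powr p \<le> s powr p + 2 powr \<bar>p\<bar>"
proof (cases "p \<ge> 0")
  case True
  then have "(s + e) powr p \<le> 2 powr \<bar>p\<bar>"
    using assms by (auto intro!: powr_mono2)
  then show ?thesis by (simp add: add_increasing)
next
  case False
  then have "(s + e) powr p \<le> s powr p"
    using assms by (intro powr_mono2') auto
  then show ?thesis by (simp add: add_increasing2)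
qed

lemma divergence_norm_powr_scale:
  fixes v :: "real ^ 'n \<Rightarrow> real ^ 'n"
  assumes "(v has_derivative v') (at x)" "x \<noteq> 0"
  shows "divergence (\<lambda>y. norm y powr k *\<^sub>R v y) x
    = (x \<bullet> x) powr (k / 2) * divergence v x + k * (x \<bullet> x) powr (k / 2 - 1) * (x \<bullet> v x)"
proof -
  have "((\<lambda>s. s powr (k / 2)) has_real_derivative k / 2 * (x \<bullet> x) powr (k / 2 - 1)) (at (x \<bullet> x))"
    using assms(2) by (intro has_real_derivative_powr) simp
  from divergence_radial_scale[OF this assms(1)] show ?thesis
    by (simp add: norm_powr_eq)
qed

text \<open>The product rule for the weighted field is available only off the origin, and one point
  does not affect the integral.\<close>

lemma set_integral_lebesgue_cong_nonzero:
  fixes f g :: "real ^ 'n \<Rightarrow> real"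
  assumes "M \<in> sets lebesgue" "\<And>x. x \<noteq> 0 \<Longrightarrow> f x = g x"
  shows "(LINT x:M|lebesgue. f x) = (LINT x:M|lebesgue. g x)"
  unfolding set_lebesgue_integral_def
  by (rule integral_discrete_difference[where X="{0}"]) (use assms in auto)

text \<open>When \<open>k < 0\<close> the Jacobian \<open>r ^ (N - 1)\<close> compensates the
  singular weight: their product is at most \<open>r powr (k + N - 1) <= 1\<close>. The bound tends
  to 1 as \<open>e\<close> tends to 0, and nothing is lost in the limit because the gradient of the
  cutoff concentrates at \<open>r = 1\<close>.\<close>

lemma radial_weight_le:
  fixes r e k :: real
  assumes "0 < r" "r \<le> 1" "0 < e" "k + real N - 1 > 0" "N > 0"
  shows "(r\<^sup>2 + e) powr (k / 2) * r ^ (N - 1) \<le> (1 + e) powr (\<bar>k\<bar> / 2)"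
proof (cases "k \<ge> 0")
  case True
  have "(r\<^sup>2 + e) powr (k / 2) * r ^ (N - 1) \<le> (1 + e) powr (k / 2) * 1"
    using assms True by (intro mult_mono powr_mono2 power_le_one) (auto simp: power_le_one)
  then show ?thesis using True by simp
next
  case False
  have "(r\<^sup>2 + e) powr (k / 2) \<le> (r\<^sup>2) powr (k / 2)"
    using assms False by (intro powr_mono2') auto
  also have "\<dots> = r powr k"
    using norm_powr_eq[of r k] assms by (simp add: power2_eq_square)
  finally have "(r\<^sup>2 + e) powr (k / 2) * r ^ (N - 1) \<le> r powr k * r ^ (N - 1)"
    using assms by (intro mult_right_mono) auto
  also have "\<dots> = r powr (k + real N - 1)"
  proof -
    have "r ^ (N - 1) = r powr (real N - 1)"
      using assms by (simp add: powr_realpow[symmetric] of_nat_diff)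
    then show ?thesis using assms by (simp add: powr_add[symmetric] add_diff_eq)
  qed
  also have "\<dots> \<le> r powr 0"
    using assms by (intro powr_mono') auto
  also have "\<dots> \<le> (1 + e) powr (\<bar>k\<bar> / 2)"
    using assms by (simp add: ge_one_powr_ge_zero)
  finally show ?thesis .
qed

lemma perimeter_ball_le:
  fixes k :: real
  assumes k: "k + real CARD('n) - 1 > 0"
  shows "perimeter k (ball (0::real ^ 'n) 1) \<le> ereal (CARD('n) * omega TYPE('n))"
  unfolding perimeter_def
proof (rule SUP_least)
  fix v :: "real ^ 'n \<Rightarrow> real ^ 'n"
  let ?N = "CARD('n)" and ?c = "CARD('n) * omega TYPE('n)" and ?B = "ball (0::real ^ 'n) 1"
  assume "v \<in> {v. C1_compact_support v \<and> (\<forall>x\<in>?B. norm (v x) \<le> 1)}"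
  then obtain v' where v': "\<And>x. (v has_derivative blinfun_apply (v' x)) (at x)"
    and v'c: "continuous_on UNIV v'" and v1: "\<And>x. x \<in> ?B \<Longrightarrow> norm (v x) \<le> 1"
    by (auto simp: C1_compact_support_def)
  have vc: "continuous_on UNIV v"
    using v' by (meson differentiableI differentiable_imp_continuous_within continuous_at_imp_continuous_on)
  have dc: "continuous_on UNIV (divergence v)"
  proof -
    have "divergence v = (\<lambda>x. \<Sum>i\<in>UNIV. v' x (axis i 1) $ i)"
      using divergence_eq_sum[OF v'] by blast
    then show ?thesis by (auto intro!: continuous_intros v'c)
  qed
  have [measurable]: "v \<in> borel_measurable borel" "divergence v \<in> borel_measurable borel"
    using vc dc by (auto intro: borel_measurable_continuous_onI)
  have "compact (divergence v ` cball 0 1)"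
    by (intro compact_continuous_image continuous_on_subset[OF dc]) auto
  then obtain b where b: "\<And>x. x \<in> cball 0 1 \<Longrightarrow> \<bar>divergence v x\<bar> \<le> b"
    by (force dest!: compact_imp_bounded simp: bounded_iff)
  have b0: "0 \<le> b" using b[of 0] by simp
  define G where "G x = (x \<bullet> x) powr (k / 2) * divergence v x + k * (x \<bullet> x) powr (k / 2 - 1) * (x \<bullet> v x)" for x
  have [measurable]: "G \<in> borel_measurable borel"
    unfolding G_def by measurable
  have "(LINT x:?B|lebesgue. divergence (\<lambda>y. norm y powr k *\<^sub>R v y) x) = (LINT x:?B|lebesgue. G x)"
    by (rule set_integral_lebesgue_cong_nonzero) (simp_all add: G_def divergence_norm_powr_scale[OF v'])
  also have "\<dots> = (\<integral>x. indicator ?B x * G x \<partial>lborel)"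
    unfolding set_lebesgue_integral_def
    by (subst integral_completion) (auto intro!: borel_measurable_times borel_measurable_indicator)
  finally have LG: "(LINT x:?B|lebesgue. divergence (\<lambda>y. norm y powr k *\<^sub>R v y) x) = \<dots>" .

  \<comment> \<open>The weight \<open>|x|\<^sup>k\<close> is regularised to \<open>(|x|\<^sup>2 + e)\<^bsup>k/2\<^esup>\<close>; the cutoff \<open>\<rho> n\<close> increases to the
    indicator of the ball. Both are functions of \<open>s = |x|\<^sup>2\<close>.\<close>
  define e where "e n = 1 / real (Suc n)" for n
  define w where "w n s = (s + e n) powr (k / 2)" for n s
  define w' where "w' n s = k / 2 * (s + e n) powr (k / 2 - 1)" for n s
  define \<rho> where "\<rho> n s = (max 0 (1 - s ^ Suc n))\<^sup>2" for n and s :: real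
  define \<rho>' where "\<rho>' n s = - 2 * Suc n * s ^ n * max 0 (1 - s ^ Suc n)" for n and s :: real
  \<comment> \<open>The divergence of the regularised, cut-off field is \<open>A n + B n\<close>: in
    \<open>A n\<close> the cutoff is not differentiated, in \<open>B n\<close> it is. Their
    integrals cancel; \<open>A n\<close> tends to the integrand of interest, and \<open>B n\<close>
    is the boundary term to be estimated.\<close>
  define A where "A n x = \<rho> n (x \<bullet> x) * (w n (x \<bullet> x) * divergence v x + 2 * w' n (x \<bullet> x) * (x \<bullet> v x))" for n x
  define B where "B n x = 2 * w n (x \<bullet> x) * \<rho>' n (x \<bullet> x) * (x \<bullet> v x)" for n x
  have e: "0 < e n" "e n \<le> 1" for n by (auto simp: e_def)
  have en0: "x \<bullet> x + e n \<noteq> 0" for n and x :: "real ^ 'n"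
    using e(1)[of n] inner_ge_zero[of x] by linarith
  have \<rho>out: "\<rho> n (x \<bullet> x) = 0" "\<rho>' n (x \<bullet> x) = 0" if "x \<notin> ?B" for n and x :: "real ^ 'n"
  proof -
    have "1 \<le> x \<bullet> x" using that by (simp add: power2_norm_eq_inner[symmetric])
    then have "1 \<le> (x \<bullet> x) ^ Suc n" by (rule one_le_power)
    then show "\<rho> n (x \<bullet> x) = 0" "\<rho>' n (x \<bullet> x) = 0"
      unfolding \<rho>_def \<rho>'_def by simp_all
  qed
  have wder: "((\<lambda>s. w n s * \<rho> n s) has_real_derivative w' n (x \<bullet> x) * \<rho> n (x \<bullet> x) + w n (x \<bullet> x) * \<rho>' n (x \<bullet> x))
      (at (x \<bullet> x))" for n and x :: "real ^ 'n"
  proof -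
    have 1: "(w n has_real_derivative w' n (x \<bullet> x)) (at (x \<bullet> x))"
    proof -
      have "0 < x \<bullet> x + e n" using e(1)[of n] inner_ge_zero[of x] by linarith
      then show ?thesis
        unfolding w_def w'_def by (auto intro!: derivative_eq_intros)
    qed
    have "((\<lambda>s. 1 - s ^ Suc n) has_real_derivative - (Suc n * (x \<bullet> x) ^ n)) (at (x \<bullet> x))"
      by (auto intro!: derivative_eq_intros simp del: power_Suc)
    from DERIV_chain2[OF has_real_derivative_pos_part_square this]
    have 2: "(\<rho> n has_real_derivative \<rho>' n (x \<bullet> x)) (at (x \<bullet> x))"
      unfolding \<rho>_def \<rho>'_def by (simp add: mult_ac del: power_Suc of_nat_Suc)
    from DERIV_mult[OF 1 2] show ?thesis by (simp add: algebra_simps)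
  qed
  have wc: "continuous_on UNIV (\<lambda>x::real ^ 'n. w n (x \<bullet> x))" "continuous_on UNIV (\<lambda>x::real ^ 'n. w' n (x \<bullet> x))"
    "continuous_on UNIV (\<lambda>x::real ^ 'n. \<rho> n (x \<bullet> x))" "continuous_on UNIV (\<lambda>x::real ^ 'n. \<rho>' n (x \<bullet> x))" for n
    unfolding w_def w'_def \<rho>_def \<rho>'_def using en0 by (auto intro!: continuous_intros)
  have Aint: "integrable lborel (A n)" and Bint: "integrable lborel (B n)" for n
    by (rule integrable_compact_support[where R=1]; unfold A_def B_def;
        auto intro!: continuous_intros wc vc dc simp: \<rho>out)+
  have [measurable]: "A n \<in> borel_measurable borel" for n
    using Aint[of n] by auto
  have AB: "(\<integral>x. A n x \<partial>lborel) = - (\<integral>x. B n x \<partial>lborel)" for n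
  proof -
    let ?F = "\<lambda>y. (w n (y \<bullet> y) * \<rho> n (y \<bullet> y)) *\<^sub>R v y"
    have "divergence ?F x = A n x + B n x" for x
      using divergence_radial_scale[OF wder v', of n x] by (simp add: A_def B_def algebra_simps)
    then have "(\<integral>x. A n x + B n x \<partial>lborel) = (\<integral>x. divergence ?F x \<partial>lborel)"
      by simp
    also have "\<dots> = 0"
      by (rule integral_divergence_eq_0(1)[OF has_derivative_radial_scale[OF wder v'], where R=1])
        (auto intro!: continuous_intros wc vc v'c simp: \<rho>out)
    finally show ?thesis using Aint Bint by simp
  qed
  have Ale: "(\<integral>x. A n x \<partial>lborel) \<le> ?c * (1 + e n) powr (\<bar>k\<bar> / 2)" for n
  proof -
    \<comment> \<open>This is minus the derivative of \<open>\<rho> n (r\<^sup>2)\<close>, so its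
      integral over \<open>[0, 1]\<close> is 1 for every \<open>n\<close>.\<close>
    define d where "d r = 4 * real (Suc n) * r ^ (2 * n + 1) * (1 - r ^ (2 * Suc n))" for r :: real
    have d0: "0 \<le> d r" if "0 \<le> r" "r \<le> 1" for r
      unfolding d_def using that by (intro mult_nonneg_nonneg) (auto simp: power_le_one simp del: power_Suc)
    define h where "h r = (if 0 \<le> r \<and> r \<le> 1 then (r\<^sup>2 + e n) powr (k / 2) * d r else 0)" for r
    have Bh: "norm (B n x) \<le> h (norm x)" for x
    proof (cases "x \<in> ?B")
      case True
      then have nx: "norm x < 1" by simp
      have s: "x \<bullet> x = (norm x)\<^sup>2" by (simp add: power2_norm_eq_inner)
      have "norm x ^ (2 * Suc n) \<le> 1" using nx by (intro power_le_one) auto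
      then have \<rho>': "\<rho>' n (x \<bullet> x) = - 2 * Suc n * norm x ^ (2 * n) * (1 - norm x ^ (2 * Suc n))"
        unfolding \<rho>'_def s power_mult[symmetric] by (simp only: max_absorb2 diff_ge_0_iff_ge)
      have "\<bar>x \<bullet> v x\<bar> \<le> norm x * norm (v x)" by (rule Cauchy_Schwarz_ineq2)
      also have "\<dots> \<le> norm x * 1" using v1[OF True] by (intro mult_left_mono) auto
      finally have "\<bar>x \<bullet> v x\<bar> \<le> norm x" by simp
      then have "norm (B n x) \<le> 2 * w n (x \<bullet> x) * \<bar>\<rho>' n (x \<bullet> x)\<bar> * norm x"
        unfolding B_def by (auto simp: abs_mult w_def intro!: mult_left_mono)
      also have "\<bar>\<rho>' n (x \<bullet> x)\<bar> = 2 * Suc n * norm x ^ (2 * n) * (1 - norm x ^ (2 * Suc n))"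
        using \<open>norm x ^ (2 * Suc n) \<le> 1\<close> unfolding \<rho>' by (simp add: abs_mult del: power_Suc)
      also have "2 * w n (x \<bullet> x) * (2 * Suc n * norm x ^ (2 * n) * (1 - norm x ^ (2 * Suc n))) * norm x = h (norm x)"
        using nx unfolding h_def w_def d_def s by (simp add: mult_ac)
      finally show ?thesis .
    next
      case False
      then show ?thesis using d0[of "norm x"] by (simp add: B_def \<rho>out h_def)
    qed
    have hm [measurable]: "h \<in> borel_measurable borel"
      unfolding h_def d_def by measurable
    have hw: "ennreal (h r) * ennreal (r ^ (?N - 1)) * indicator {0..} r
        \<le> ennreal ((1 + e n) powr (\<bar>k\<bar> / 2)) * (ennreal (d r) * indicator {0..1} r)" for r
    proof (cases "0 < r \<and> r \<le> 1")
      case True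
      have "h r * r ^ (?N - 1) = ((r\<^sup>2 + e n) powr (k / 2) * r ^ (?N - 1)) * d r"
        using True by (simp add: h_def)
      also have "\<dots> \<le> (1 + e n) powr (\<bar>k\<bar> / 2) * d r"
        using True e[of n] k d0 by (intro mult_right_mono radial_weight_le) auto
      finally show ?thesis using True d0[of r]
        by (simp add: ennreal_mult'[symmetric] ennreal_mult''[symmetric])
    next
      case False
      then show ?thesis by (auto simp: h_def d_def)
    qed
    \<comment> \<open>A negative integral becomes 0 in \<open>ennreal\<close>, which is harmless
      since only a nonnegative upper bound is sought.\<close>
    have "ennreal (\<integral>x. A n x \<partial>lborel) \<le> ennreal (norm (\<integral>x. B n x \<partial>lborel))"
      unfolding AB by (rule ennreal_leI) simp
    also have "\<dots> \<le> (\<integral>\<^sup>+x. ennreal (norm (B n x)) \<partial>lborel)"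
      by (rule integral_norm_bound_ennreal[OF Bint])
    also have "\<dots> \<le> (\<integral>\<^sup>+(x::real ^ 'n). ennreal (h (norm x)) \<partial>lborel)"
      by (intro nn_integral_mono ennreal_leI Bh)
    also have "\<dots> = ennreal ?c * (\<integral>\<^sup>+r. ennreal (h r) * ennreal (r ^ (?N - 1)) * indicator {0..} r \<partial>lborel)"
      by (rule nn_integral_radial) simp
    also have "\<dots> \<le> ennreal ?c * (\<integral>\<^sup>+r. ennreal ((1 + e n) powr (\<bar>k\<bar> / 2)) * (ennreal (d r) * indicator {0..1} r) \<partial>lborel)"
      by (intro mult_left_mono nn_integral_mono hw) auto
    also have "\<dots> = ennreal ?c * (ennreal ((1 + e n) powr (\<bar>k\<bar> / 2)) * (\<integral>\<^sup>+r. ennreal (d r) * indicator {0..1} r \<partial>lborel))"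
      by (subst nn_integral_cmult) (auto simp: d_def)
    also have "(\<integral>\<^sup>+r. ennreal (d r) * indicator {0..1} r \<partial>lborel)
        = ennreal (- ((1 - 1 ^ (2 * Suc n))\<^sup>2) - (- ((1 - 0 ^ (2 * Suc n))\<^sup>2)))"
    proof (rule nn_integral_FTC_Icc[where F="\<lambda>r. - ((1 - r ^ (2 * Suc n))\<^sup>2)"])
      fix r :: real assume "r \<in> {0..1}"
      show "((\<lambda>r. - ((1 - r ^ (2 * Suc n))\<^sup>2)) has_real_derivative d r) (at r)"
      proof -
        have "((\<lambda>r. r ^ (2 * Suc n)) has_real_derivative 2 * real (Suc n) * r ^ (2 * n + 1)) (at r)"
          using DERIV_pow[of "2 * Suc n" r UNIV] by simp
        from DERIV_minus[OF DERIV_power[OF DERIV_diff[OF DERIV_const[of 1] this], of 2]]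
        show ?thesis unfolding d_def by (simp add: mult_ac del: of_nat_Suc)
      qed
    next
      show "d \<in> borel_measurable borel" unfolding d_def by measurable
    qed (use d0 in auto)
    finally have "ennreal (\<integral>x. A n x \<partial>lborel) \<le> ennreal (?c * (1 + e n) powr (\<bar>k\<bar> / 2))"
      using omega_pos[where 'n='n] by (simp add: ennreal_mult[symmetric])
    then show ?thesis
      using omega_pos[where 'n='n] by (subst (asm) ennreal_le_iff) auto
  qed
  \<comment> \<open>The two powers are those of the undifferentiated and of the differentiated
    weight. The more singular one, with exponent \<open>k - 1\<close>, is integrable on the ball
    since \<open>k - 1 + N > 0\<close>.\<close>
  define D where "D x = indicator ?B x * (b * (norm x powr k + 2 powr \<bar>k / 2\<bar>)
      + \<bar>k\<bar> * (norm x powr (k - 1) + 2 powr \<bar>(k - 1) / 2\<bar>))" for x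
  have Dint: "integrable lborel D"
  proof -
    have "integrable lborel (\<lambda>x::real ^ 'n. b * (indicator ?B x * norm x powr k) + b * 2 powr \<bar>k / 2\<bar> * indicator ?B x
        + \<bar>k\<bar> * (indicator ?B x * norm x powr (k - 1)) + \<bar>k\<bar> * 2 powr \<bar>(k - 1) / 2\<bar> * indicator ?B x)"
      using k by (intro Bochner_Integration.integrable_add integrable_mult_right integrable_norm_powr_ball
          integrable_real_indicator) (auto simp: emeasure_lborel_ball_finite[simplified])
    then show ?thesis unfolding D_def by (simp add: algebra_simps)
  qed
  have AD: "norm (A n x) \<le> D x" if x: "x \<noteq> 0" for n x
  proof (cases "x \<in> ?B")
    case True
    let ?s = "x \<bullet> x"
    have s: "0 < ?s" "?s \<le> 1"
      using x True by (auto simp: power2_norm_eq_inner[symmetric] power_le_one)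
    have w: "w n ?s \<le> norm x powr k + 2 powr \<bar>k / 2\<bar>"
      unfolding w_def norm_powr_eq using s e by (intro powr_shift_le) auto
    have "\<bar>x \<bullet> v x\<bar> \<le> norm x * norm (v x)" by (rule Cauchy_Schwarz_ineq2)
    also have "\<dots> \<le> norm x * 1" using v1[OF True] by (intro mult_left_mono) auto
    \<comment> \<open>This half power raises the exponent \<open>k / 2 - 1\<close> of the
      differentiated weight to \<open>(k - 1) / 2\<close>, giving \<open>|x|^(k - 1)\<close> in the
      majorant instead of \<open>|x|^(k - 2)\<close>.\<close>
    also have "\<dots> \<le> (?s + e n) powr (1/2)"
      using e[of n] s by (simp add: norm_eq_sqrt_inner powr_half_sqrt)
    finally have xv: "\<bar>x \<bullet> v x\<bar> \<le> (?s + e n) powr (1/2)" .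
    have "\<bar>2 * w' n ?s * (x \<bullet> v x)\<bar> = \<bar>k\<bar> * ((?s + e n) powr (k / 2 - 1) * \<bar>x \<bullet> v x\<bar>)"
      by (simp add: w'_def abs_mult)
    also have "\<dots> \<le> \<bar>k\<bar> * ((?s + e n) powr (k / 2 - 1) * (?s + e n) powr (1/2))"
      by (intro mult_left_mono xv) auto
    also have "\<dots> = \<bar>k\<bar> * (?s + e n) powr ((k - 1) / 2)"
      by (simp add: powr_add[symmetric] diff_divide_distrib)
    also have "\<dots> \<le> \<bar>k\<bar> * (norm x powr (k - 1) + 2 powr \<bar>(k - 1) / 2\<bar>)"
      unfolding norm_powr_eq using s e by (intro mult_left_mono powr_shift_le) auto
    finally have w': "\<bar>2 * w' n ?s * (x \<bullet> v x)\<bar> \<le> \<dots>" .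
    have "\<bar>w n ?s * divergence v x\<bar> \<le> (norm x powr k + 2 powr \<bar>k / 2\<bar>) * b"
      unfolding abs_mult using w b[of x] True by (intro mult_mono) (auto simp: w_def)
    with w' have 1: "\<bar>w n ?s * divergence v x + 2 * w' n ?s * (x \<bullet> v x)\<bar>
        \<le> b * (norm x powr k + 2 powr \<bar>k / 2\<bar>) + \<bar>k\<bar> * (norm x powr (k - 1) + 2 powr \<bar>(k - 1) / 2\<bar>)"
      by (intro order_trans[OF abs_triangle_ineq] add_mono) (simp_all add: mult.commute)
    have \<rho>: "0 \<le> \<rho> n ?s" "\<rho> n ?s \<le> 1"
      using s by (auto simp: \<rho>_def power_le_one simp del: power_Suc)
    have "norm (A n x) \<le> 1 * \<bar>w n ?s * divergence v x + 2 * w' n ?s * (x \<bullet> v x)\<bar>"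
      unfolding A_def real_norm_def abs_mult using \<rho> by (intro mult_right_mono) auto
    with 1 show ?thesis using True by (simp add: D_def)
  qed (simp add: A_def \<rho>out D_def)
  have Alim: "(\<lambda>n. A n x) \<longlonglongrightarrow> indicator ?B x * G x" if x: "x \<noteq> 0" for x
  proof (cases "x \<in> ?B")
    case True
    let ?s = "x \<bullet> x"
    have s: "0 < ?s" "?s < 1"
      using x True by (auto simp: power2_norm_eq_inner[symmetric] power_less_one_iff)
    have e0: "e \<longlonglongrightarrow> 0"
      unfolding e_def using LIMSEQ_inverse_real_of_nat by (simp add: inverse_eq_divide)
    have s0: "(\<lambda>n. ?s ^ Suc n) \<longlonglongrightarrow> 0"
      using LIMSEQ_power_zero[of ?s] s by (intro LIMSEQ_Suc) auto
    have "(\<lambda>n. A n x) \<longlonglongrightarrow> (max 0 (1 - 0))\<^sup>2 * ((?s + 0) powr (k / 2) * divergence v x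
        + 2 * (k / 2 * (?s + 0) powr (k / 2 - 1)) * (x \<bullet> v x))"
      unfolding A_def \<rho>_def w_def w'_def using s by (intro tendsto_intros e0 s0) auto
    then show ?thesis using True by (simp add: G_def)
  qed (simp add: A_def \<rho>out)
  have "(\<lambda>n. \<integral>x. A n x \<partial>lborel) \<longlonglongrightarrow> (\<integral>x. indicator ?B x * G x \<partial>lborel)"
  proof (rule integral_dominated_convergence[where w=D])
    show "AE x in lborel. (\<lambda>n. A n x) \<longlonglongrightarrow> indicator ?B x * G x"
      using AE_lborel_singleton[of 0] by eventually_elim (rule Alim)
    show "AE x in lborel. norm (A n x) \<le> D x" for n
      using AE_lborel_singleton[of 0] by eventually_elim (rule AD)
  qed (use Dint in \<open>auto intro!: borel_measurable_times borel_measurable_indicator\<close>)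
  moreover have "(\<lambda>n. ?c * (1 + e n) powr (\<bar>k\<bar> / 2)) \<longlonglongrightarrow> ?c * (1 + 0) powr (\<bar>k\<bar> / 2)"
    using LIMSEQ_inverse_real_of_nat
    by (intro tendsto_intros) (auto simp: e_def inverse_eq_divide)
  ultimately have "(\<integral>x. indicator ?B x * G x \<partial>lborel) \<le> ?c * (1 + 0) powr (\<bar>k\<bar> / 2)"
    by (rule LIMSEQ_le) (use Ale in auto)
  then show "ereal (LINT x:?B|lebesgue. divergence (\<lambda>y. norm y powr k *\<^sub>R v y) x) \<le> ereal ?c"
    unfolding LG by simp
qed

section \<open>Lower bound for the perimeter by a weighted measure\<close>

lemma integrable_mu_density:
  fixes M :: "(real ^ 'n) set"
  assumes M: "M \<in> sets lebesgue" and fin: "emeasure (mu l) M < \<infinity>"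
  shows "integrable lebesgue (\<lambda>x. indicator M x * norm x powr l)"
    and "(\<integral>x. indicator M x * norm x powr l \<partial>lebesgue) = measure (mu l) M"
proof -
  have meas: "(\<lambda>x. indicator M x * norm x powr l) \<in> borel_measurable lebesgue"
    using M by (intro borel_measurable_times borel_measurable_indicator) (auto intro!: measurable_completion)
  have "(\<integral>\<^sup>+x. ennreal (indicator M x * norm x powr l) \<partial>lebesgue) = emeasure (mu l) M"
    unfolding emeasure_mu_eq[OF M] by (auto intro!: nn_integral_cong simp: indicator_def)
  also have "\<dots> = ennreal (measure (mu l) M)"
    using fin by (simp add: emeasure_eq_ennreal_measure)
  finally have "integrable lebesgue (\<lambda>x. indicator M x * norm x powr l) \<and>
      (\<integral>x. indicator M x * norm x powr l \<partial>lebesgue) = measure (mu l) M"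
    by (subst (asm) nn_integral_eq_integrable[OF meas]) auto
  then show "integrable lebesgue (\<lambda>x. indicator M x * norm x powr l)"
    and "(\<integral>x. indicator M x * norm x powr l \<partial>lebesgue) = measure (mu l) M" by auto
qed

text \<open>The derivative must be continuous in operator norm; in finite dimension this follows
  from continuity of \<open>D x h\<close> for each fixed \<open>h\<close>. Conditions on
  \<open>g\<close> for \<open>s >= 0\<close> suffice because \<open>x \<bullet> x\<close> is
  nonnegative.\<close>

lemma C1_compact_support_radial:
  fixes g g' :: "real \<Rightarrow> real"
  assumes der: "\<And>s. s \<ge> 0 \<Longrightarrow> (g has_real_derivative g' s) (at s)"
    and cont: "continuous_on {0..} g'" and supp: "\<And>s. s \<ge> r \<Longrightarrow> g s = 0"
  shows "C1_compact_support (\<lambda>x::real ^ 'n. g (x \<bullet> x) *\<^sub>R x)"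
proof -
  define D where "D x h = g (x \<bullet> x) *\<^sub>R h + (2 * g' (x \<bullet> x) * (x \<bullet> h)) *\<^sub>R x" for x h :: "real ^ 'n"
  have D: "((\<lambda>x. g (x \<bullet> x) *\<^sub>R x) has_derivative D x) (at x)" for x
    unfolding D_def by (intro has_derivative_radial_scale der has_derivative_ident inner_ge_zero)
  have [simp]: "blinfun_apply (Blinfun (D x)) = D x" for x
    using has_derivative_bounded_linear[OF D] by (rule bounded_linear_Blinfun_apply)
  have gc: "continuous_on {0..} g"
    using der by (intro DERIV_continuous_on[where D=g']) (auto intro: has_field_derivative_at_within)
  have cg: "continuous_on UNIV (\<lambda>x::real ^ 'n. g (x \<bullet> x))"
    by (rule continuous_on_compose2[OF gc]) (auto intro!: continuous_intros)
  have cg': "continuous_on UNIV (\<lambda>x::real ^ 'n. g' (x \<bullet> x))"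
    by (rule continuous_on_compose2[OF cont]) (auto intro!: continuous_intros)
  have "continuous_on UNIV (\<lambda>x. D x h)" for h
    unfolding D_def by (intro continuous_intros cg cg')
  then have "continuous_on UNIV (\<lambda>x. Blinfun (D x))"
    unfolding continuous_on_def by (auto intro!: tendsto_componentwise1)
  moreover have "compact (closure {x::real ^ 'n. g (x \<bullet> x) *\<^sub>R x \<noteq> 0})"
  proof -
    have "{x::real ^ 'n. g (x \<bullet> x) *\<^sub>R x \<noteq> 0} \<subseteq> ball 0 (sqrt r)"
    proof
      fix x :: "real ^ 'n" assume "x \<in> {x. g (x \<bullet> x) *\<^sub>R x \<noteq> 0}"
      then have "x \<bullet> x < r" using supp[of "x \<bullet> x"] by (auto simp: not_le[symmetric])
      then show "x \<in> ball 0 (sqrt r)" by (simp add: norm_eq_sqrt_inner)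
    qed
    then show ?thesis
      by (simp add: compact_closure bounded_subset[OF bounded_ball])
  qed
  ultimately show ?thesis
    unfolding C1_compact_support_def using D by (auto intro!: exI[of _ "\<lambda>x. Blinfun (D x)"])
qed

text \<open>Keeping the full power and dividing by \<open>f s\<close>, instead of lowering the
  exponent, lets the powers be factored out of the derivative of a product.\<close>

lemma has_real_derivative_powr_compose:
  fixes r :: real
  assumes "(f has_real_derivative c) (at s)" "0 < f s"
  shows "((\<lambda>s. f s powr r) has_real_derivative r * f s powr r / f s * c) (at s)"
  using DERIV_chain2[OF has_real_derivative_powr[OF assms(2), of r] assms(1)] assms(2)
  by (simp add: powr_diff)

text \<open>Finiteness of \<open>mu (k - 1) M\<close> is not known beforehand, so the inequality is
  stated in \<open>ennreal\<close>. Two limits are taken in turn: \<open>m\<close> removes the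
  compact support, dominated by the \<open>mu l\<close> density on \<open>M\<close>; then
  \<open>n\<close> restores \<open>x / |x|\<close> by Fatou's lemma.\<close>

lemma weighted_measure_le_perimeter:
  fixes k l P :: real and M :: "(real ^ 'n) set"
  assumes k: "k + real CARD('n) - 1 > 0" and l: "l + real CARD('n) > 0" and lk: "l + 1 \<le> k"
    and M: "M \<in> sets lebesgue" and fin: "emeasure (mu l) M < \<infinity>"
    and P: "perimeter k M \<le> ereal P"
  shows "ennreal (k + CARD('n) - 1) * emeasure (mu (k - 1)) M \<le> ennreal P"
proof -
  define a where "a = k + CARD('n) - 1"
  have a: "a > 0" using k by (simp add: a_def)
  \<comment> \<open>The factor \<open>(1 + e s)\<^bsup>-a/2\<^esup>\<close> makes \<open>|x|\<^sup>k q(|x|\<^sup>2)\<close> decay like \<open>|x|\<^bsup>-N\<^esup>\<close>, so that it is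
    dominated by a multiple of \<open>|x|\<^sup>l\<close>, which is integrable on \<open>M\<close>, while keeping the divergence
    nonnegative. The last truncation \<open>\<kappa>\<close> can then be removed by dominated convergence.\<close>
  define e where "e n = 1 / real (Suc n)" for n
  \<comment> \<open>The first factor is \<open>1 / |x|\<close> smoothed at the origin. In the
    second, an exponent parameter larger than \<open>a\<close> would make the divergence negative
    for large \<open>|x|\<close>.\<close>
  define q where "q n s = (s + e n) powr (- 1 / 2) * (1 + e n * s) powr (- a / 2)" for n s
  define H where "H n x = norm x powr k * q n (x \<bullet> x) * (e n / (x \<bullet> x + e n) + a / (1 + e n * (x \<bullet> x)))"
    for n and x :: "real ^ 'n"
  have e: "0 < e n" "e n \<le> 1" for n by (auto simp: e_def)
  have e0: "e \<longlonglongrightarrow> 0"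
    unfolding e_def using LIMSEQ_inverse_real_of_nat by (simp add: inverse_eq_divide)
  have pos: "0 < s + e n" "0 < 1 + e n * s" if "0 \<le> s" for s n
    using that e[of n] by (auto intro: add_nonneg_pos add_pos_nonneg)
  have H0: "0 \<le> H n x" for n x
    unfolding H_def q_def using pos[of "x \<bullet> x" n] e[of n] a
    by (intro mult_nonneg_nonneg add_nonneg_nonneg divide_nonneg_nonneg) auto
  have indM [measurable]: "(indicator M :: _ \<Rightarrow> real) \<in> borel_measurable lebesgue"
    using M by simp
  have Hm [measurable]: "H n \<in> borel_measurable lebesgue" for n
    unfolding H_def q_def by (rule measurable_completion) measurable
  have Hle: "(\<integral>\<^sup>+x. ennreal (indicator M x * H n x) \<partial>lebesgue) \<le> ennreal P" for n
  proof -
    define \<kappa> where "\<kappa> m s = (max 0 (1 - s / real (Suc m)))\<^sup>2" for m s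
    define \<kappa>' where "\<kappa>' m s = - 2 / real (Suc m) * max 0 (1 - s / real (Suc m))" for m s
    \<comment> \<open>\<open>q n\<close> times its logarithmic derivative, so that
      \<open>q n\<close> factors out of the divergence.\<close>
    define q' where "q' s = - q n s / 2 * (1 / (s + e n) + a * e n / (1 + e n * s))" for s
    define v where "v m x = (q n (x \<bullet> x) * \<kappa> m (x \<bullet> x)) *\<^sub>R x" for m and x :: "real ^ 'n"
    define E where "E m x = norm x powr k * q n (x \<bullet> x) *
      ((e n / (x \<bullet> x + e n) + a / (1 + e n * (x \<bullet> x))) * \<kappa> m (x \<bullet> x) + 2 * (x \<bullet> x) * \<kappa>' m (x \<bullet> x))"
      for m and x :: "real ^ 'n"
    have q0: "0 \<le> q n s" for s by (simp add: q_def)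
    have qder: "(q n has_real_derivative q' s) (at s)" if "0 \<le> s" for s
    proof -
      note p = pos[OF that, of n]
      have "((\<lambda>s. s + e n) has_real_derivative 1) (at s)"
        by (rule DERIV_cong[OF DERIV_add[OF DERIV_ident DERIV_const]]) simp
      note d1 = has_real_derivative_powr_compose[OF this, OF p(1)]
      have "((\<lambda>s. 1 + e n * s) has_real_derivative e n) (at s)"
        by (rule DERIV_cong[OF DERIV_add[OF DERIV_const DERIV_cmult_Id]]) simp
      note d2 = has_real_derivative_powr_compose[OF this, OF p(2)]
      have alg: "- 1 / 2 * A / X * 1 * B + - a / 2 * B / Y * c * A = - (A * B) / 2 * (1 / X + a * c / Y)"
        for A B X Y c :: real
        by (simp add: distrib_left mult_ac)
      show ?thesis
        unfolding q'_def q_def by (rule DERIV_cong[OF DERIV_mult[OF d1 d2] alg])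
    qed
    have \<kappa>der: "(\<kappa> m has_real_derivative \<kappa>' m s) (at s)" for m s
    proof -
      have "((\<lambda>s. 1 - s / real (Suc m)) has_real_derivative - 1 / real (Suc m)) (at s)"
        by (auto intro!: derivative_eq_intros)
      from DERIV_chain2[OF has_real_derivative_pos_part_square this]
      show ?thesis unfolding \<kappa>_def \<kappa>'_def by simp
    qed
    have \<kappa>01: "0 \<le> \<kappa> m s" "\<kappa> m s \<le> 1" if "0 \<le> s" for m s
      using that by (auto simp: \<kappa>_def power_le_one)
    \<comment> \<open>The term is scale invariant: with \<open>t = s / (m + 1)\<close> its modulus
      is \<open>4 t (1 - t)\<close> cut off at \<open>t = 1\<close>, hence at most 1 uniformly in
      \<open>m\<close>.\<close>
    have \<kappa>'b: "\<bar>2 * s * \<kappa>' m s\<bar> \<le> 1" if "0 \<le> s" for m s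
    proof -
      define t where "t = s / real (Suc m)"
      have "0 \<le> t" using that by (simp add: t_def)
      have "\<bar>2 * s * \<kappa>' m s\<bar> = 4 * t * max 0 (1 - t)"
        using that by (simp add: \<kappa>'_def t_def abs_mult)
      also have "\<dots> \<le> 1"
      proof (cases "t \<le> 1")
        case True
        have "0 \<le> (2 * t - 1)\<^sup>2" by simp
        with True show ?thesis by (simp add: power2_eq_square algebra_simps)
      qed auto
      finally show ?thesis .
    qed
    have dv: "divergence (\<lambda>y. norm y powr k *\<^sub>R v m y) x = E m x" if x: "x \<noteq> 0" for m x
    proof -
      let ?s = "x \<bullet> x"
      have s: "0 < ?s" using x by simp
      have 1: "((\<lambda>s. s powr (k / 2)) has_real_derivative k / 2 * ?s powr (k / 2) / ?s) (at ?s)"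
        using has_real_derivative_powr[OF s, of "k / 2"] s by (simp add: powr_diff)
      have "divergence (\<lambda>y. ((y \<bullet> y) powr (k / 2) * (q n (y \<bullet> y) * \<kappa> m (y \<bullet> y))) *\<^sub>R y) x
          = (?s powr (k / 2) * (q n ?s * \<kappa> m ?s)) * CARD('n) +
            2 * (k / 2 * ?s powr (k / 2) / ?s * (q n ?s * \<kappa> m ?s)
              + (q' ?s * \<kappa> m ?s + \<kappa>' m ?s * q n ?s) * ?s powr (k / 2)) * ?s"
        using divergence_radial_scale[OF DERIV_mult[OF 1 DERIV_mult[OF qder \<kappa>der]] has_derivative_ident, of m] s
        by (simp add: divergence_ident)
      also have "\<dots> = ?s powr (k / 2) * q n ?s * ((CARD('n) + k - ?s / (?s + e n) - a * e n * ?s / (1 + e n * ?s)) * \<kappa> m ?s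
          + 2 * ?s * \<kappa>' m ?s)"
      proof -
        have "W * (Q * c) * N + 2 * (k / 2 * W / z * (Q * c) + (- Q / 2 * (1 / X + a * f / Y) * c + d * Q) * W) * z
            = W * Q * ((N + k - z / X - a * f * z / Y) * c + 2 * z * d)"
          if "X \<noteq> 0" "Y \<noteq> 0" "z \<noteq> 0" for W Q c d N z X Y f :: real
          using that by (simp add: field_simps)
        from this[of "?s + e n" "1 + e n * ?s" ?s] show ?thesis
          unfolding q'_def using s pos[of ?s n] by simp
      qed
      \<comment> \<open>Since \<open>N + k = 1 + a\<close>, the two subtracted fractions are
        absorbed by 1 and by \<open>a\<close> respectively; both remainders are nonnegative.\<close>
      also have "CARD('n) + k - ?s / (?s + e n) - a * e n * ?s / (1 + e n * ?s) = e n / (?s + e n) + a / (1 + e n * ?s)"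
      proof -
        have "1 - ?s / (?s + e n) = e n / (?s + e n)" "a - a * e n * ?s / (1 + e n * ?s) = a / (1 + e n * ?s)"
          using pos[of ?s n] by (simp_all add: field_simps)
        then show ?thesis by (simp add: a_def)
      qed
      finally show ?thesis by (simp add: v_def E_def norm_powr_eq)
    qed
    have vC1: "C1_compact_support (v m)" for m
      unfolding v_def
    proof (rule C1_compact_support_radial[where r="Suc m"])
      show "((\<lambda>s. q n s * \<kappa> m s) has_real_derivative q' s * \<kappa> m s + \<kappa>' m s * q n s) (at s)" if "0 \<le> s" for s
        by (rule DERIV_mult[OF qder[OF that] \<kappa>der])
      show "continuous_on {0..} (\<lambda>s. q' s * \<kappa> m s + \<kappa>' m s * q n s)"
      proof -
        have "s + e n \<noteq> 0" "1 + e n * s \<noteq> 0" if "0 \<le> s" for s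
          using pos[OF that, of n] by auto
        then show ?thesis
          unfolding q'_def q_def \<kappa>_def \<kappa>'_def by (auto intro!: continuous_intros)
      qed
    qed (auto simp: \<kappa>_def field_simps)
    have v1: "norm (v m x) \<le> 1" for m x
    proof (cases "x = 0")
      case False
      let ?s = "x \<bullet> x"
      have s: "0 < ?s" using False by simp
      have "(1 + e n * ?s) powr (- a / 2) \<le> 1 powr (- a / 2)"
        using s e[of n] a by (intro powr_mono2') auto
      then have "q n ?s \<le> ?s powr (- 1 / 2) * 1"
        unfolding q_def using s e[of n] by (intro mult_mono powr_mono2') auto
      also have "\<dots> = norm x powr (- 1)"
        by (simp only: norm_powr_eq mult_1_right)
      also have "\<dots> = 1 / norm x"
        by (simp add: powr_minus_divide)
      finally have "norm x * q n ?s \<le> 1"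
        using False by (simp add: field_simps)
      then have "norm x * q n ?s * \<kappa> m ?s \<le> 1 * 1"
        using \<kappa>01[of ?s m] by (intro mult_mono) (auto simp: q0)
      then show ?thesis using \<kappa>01[of ?s m] q0 by (simp add: v_def abs_mult mult_ac)
    qed (simp add: v_def)
    have EleP: "(\<integral>x. indicator M x * E m x \<partial>lebesgue) \<le> P" for m
    proof -
      have "ereal (LINT x:M|lebesgue. divergence (\<lambda>y. norm y powr k *\<^sub>R v m y) x) \<le> perimeter k M"
        unfolding perimeter_def by (rule SUP_upper) (auto simp: vC1 v1)
      also note P
      also have "(LINT x:M|lebesgue. divergence (\<lambda>y. norm y powr k *\<^sub>R v m y) x) = (LINT x:M|lebesgue. E m x)"
        by (rule set_integral_lebesgue_cong_nonzero[OF M dv])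
      finally show ?thesis by (simp add: set_lebesgue_integral_def)
    qed
    define C where "C = e n powr (- a / 2)"
    have C1: "1 \<le> C"
    proof -
      have "1 powr (- a / 2) \<le> C"
        unfolding C_def using e[of n] a by (intro powr_mono2') auto
      then show ?thesis by simp
    qed
    \<comment> \<open>Inside the unit ball \<open>l <= k - 1\<close> gives the comparison of powers.
      Outside it, the decay factor turns the exponent \<open>k - 1\<close> into
      \<open>k - 1 - a = -N\<close>, and \<open>-N < l\<close>. The constant \<open>C\<close>
      depends on \<open>n\<close> but not on \<open>m\<close>.\<close>
    have Wq: "norm x powr k * q n (x \<bullet> x) \<le> C * norm x powr l" if x: "x \<noteq> 0" for x :: "real ^ 'n"
    proof -
      let ?s = "x \<bullet> x"
      have s: "0 < ?s" using x by simp
      have "(?s + e n) powr (- 1 / 2) \<le> ?s powr (- 1 / 2)"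
        using s e[of n] by (intro powr_mono2') auto
      also have "\<dots> = norm x powr (- 1)"
        by (simp only: norm_powr_eq mult_1_right)
      finally have "norm x powr k * q n ?s \<le> norm x powr k * (norm x powr (- 1) * (1 + e n * ?s) powr (- a / 2))"
        unfolding q_def by (intro mult_left_mono mult_right_mono) auto
      also have "\<dots> = norm x powr (k - 1) * (1 + e n * ?s) powr (- a / 2)"
        by (simp only: powr_add[symmetric] mult.assoc[symmetric] diff_conv_add_uminus)
      also have "\<dots> \<le> C * norm x powr l"
      proof (cases "norm x \<le> 1")
        case True
        have "(1 + e n * ?s) powr (- a / 2) \<le> 1 powr (- a / 2)"
          using e[of n] s a by (intro powr_mono2') auto
        then have "norm x powr (k - 1) * (1 + e n * ?s) powr (- a / 2) \<le> norm x powr (k - 1) * C"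
          using C1 by (intro mult_left_mono) auto
        also have "\<dots> \<le> norm x powr l * C"
          using True x lk C1 by (intro mult_right_mono powr_mono') auto
        finally show ?thesis by (simp add: mult.commute)
      next
        case False
        have "(1 + e n * ?s) powr (- a / 2) \<le> (e n * ?s) powr (- a / 2)"
          using e[of n] s a by (intro powr_mono2') auto
        also have "\<dots> = C * norm x powr (- a)"
          using e[of n] s by (simp add: C_def powr_mult norm_powr_eq)
        finally have "norm x powr (k - 1) * (1 + e n * ?s) powr (- a / 2) \<le> norm x powr (k - 1) * (C * norm x powr (- a))"
          by (intro mult_left_mono) auto
        also have "\<dots> = C * norm x powr (- real CARD('n))"
          by (simp add: powr_add[symmetric] a_def mult.left_commute)
        also have "\<dots> \<le> C * norm x powr l"
          using C1 False l by (intro mult_left_mono powr_mono) auto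
        finally show ?thesis .
      qed
      finally show ?thesis .
    qed
    \<comment> \<open>In \<open>2 + a\<close>, the two fractions contribute 1 and \<open>a\<close>,
      and the derivative of the truncation contributes 1.\<close>
    have Eb: "norm (indicator M x * E m x) \<le> (2 + a) * C * (indicator M x * norm x powr l)" if x: "x \<noteq> 0" for m x
    proof -
      let ?s = "x \<bullet> x"
      have s: "0 < ?s" using x by simp
      have b1: "e n / (?s + e n) \<le> 1" "0 \<le> e n / (?s + e n)" "a / (1 + e n * ?s) \<le> a" "0 \<le> a / (1 + e n * ?s)"
        using s e[of n] a pos[of ?s n] by (auto simp: field_simps)
      have "\<bar>(e n / (?s + e n) + a / (1 + e n * ?s)) * \<kappa> m ?s\<bar> \<le> (1 + a) * 1"
        unfolding abs_mult using b1 \<kappa>01[of ?s m] s a by (intro mult_mono) auto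
      then have "\<bar>(e n / (?s + e n) + a / (1 + e n * ?s)) * \<kappa> m ?s + 2 * ?s * \<kappa>' m ?s\<bar> \<le> 2 + a"
        using \<kappa>'b[of ?s m, OF inner_ge_zero]
        by (rule order_trans[OF abs_triangle_ineq order_trans[OF add_mono]]) simp
      note b2 = this
      have "norm (E m x) = (norm x powr k * q n ?s) * \<bar>(e n / (?s + e n) + a / (1 + e n * ?s)) * \<kappa> m ?s + 2 * ?s * \<kappa>' m ?s\<bar>"
        using q0[of ?s] by (simp add: E_def abs_mult)
      also have "\<dots> \<le> (C * norm x powr l) * (2 + a)"
        using C1 by (intro mult_mono[OF Wq[OF x] b2]) auto
      finally show ?thesis by (auto simp: indicator_def mult_ac)
    qed
    have Elim: "(\<lambda>m. indicator M x * E m x) \<longlonglongrightarrow> indicator M x * H n x" for x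
    proof -
      have t0: "(\<lambda>m. x \<bullet> x / real (Suc m)) \<longlonglongrightarrow> 0"
        by (rule LIMSEQ_Suc[OF lim_const_over_n])
      have "\<kappa>' m (x \<bullet> x) * (2 * (x \<bullet> x)) = - 4 * (x \<bullet> x / real (Suc m)) * max 0 (1 - x \<bullet> x / real (Suc m))" for m
        by (simp add: \<kappa>'_def)
      moreover have "(\<lambda>m. - 4 * (x \<bullet> x / real (Suc m)) * max 0 (1 - x \<bullet> x / real (Suc m))) \<longlonglongrightarrow> - 4 * 0 * max 0 (1 - 0)"
        by (intro tendsto_intros t0)
      ultimately have t1: "(\<lambda>m. 2 * (x \<bullet> x) * \<kappa>' m (x \<bullet> x)) \<longlonglongrightarrow> 0"
        by (simp add: mult.commute)
      have t2: "(\<lambda>m. \<kappa> m (x \<bullet> x)) \<longlonglongrightarrow> (max 0 (1 - 0))\<^sup>2"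
        unfolding \<kappa>_def by (intro tendsto_intros t0)
      have "(\<lambda>m. indicator M x * E m x) \<longlonglongrightarrow> indicator M x * (norm x powr k * q n (x \<bullet> x) *
        ((e n / (x \<bullet> x + e n) + a / (1 + e n * (x \<bullet> x))) * (max 0 (1 - 0))\<^sup>2 + 0))"
        unfolding E_def by (intro tendsto_intros t1 t2)
      then show ?thesis by (simp add: H_def)
    qed
    have Em: "(\<lambda>x. indicator M x * E m x) \<in> borel_measurable lebesgue" for m
    proof -
      have "E m \<in> borel_measurable lebesgue"
        unfolding E_def q_def \<kappa>_def \<kappa>'_def by (rule measurable_completion) measurable
      then show ?thesis by measurable
    qed
    have dom: "integrable lebesgue (\<lambda>x. (2 + a) * C * (indicator M x * norm x powr l))"
      by (intro integrable_mult_right integrable_mu_density[OF M fin])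
    have n0: "AE x in lebesgue. x \<noteq> (0::real ^ 'n)"
      using AE_lborel_singleton by (rule AE_completion)
    have bnd: "AE x in lebesgue. norm (indicator M x * E m x) \<le> (2 + a) * C * (indicator M x * norm x powr l)" for m
      using n0 by eventually_elim (rule Eb)
    have "(\<lambda>m. \<integral>x. indicator M x * E m x \<partial>lebesgue) \<longlonglongrightarrow> (\<integral>x. indicator M x * H n x \<partial>lebesgue)"
      by (rule integral_dominated_convergence[where s="\<lambda>m x. indicator M x * E m x", OF _ Em dom _ bnd]) (auto simp: Elim)
    then have "(\<integral>x. indicator M x * H n x \<partial>lebesgue) \<le> P"
      by (rule LIMSEQ_le_const2) (use EleP in auto)
    moreover have "integrable lebesgue (\<lambda>x. indicator M x * H n x)"
      by (rule integrable_dominated_convergence[where s="\<lambda>m x. indicator M x * E m x", OF _ Em dom _ bnd]) (auto simp: Elim)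
    ultimately show ?thesis
      by (subst nn_integral_eq_integral) (auto simp: H0 intro: ennreal_leI)
  qed
  have Hlim: "(\<lambda>n. indicator M x * H n x) \<longlonglongrightarrow> a * (indicator M x * norm x powr (k - 1))" if x: "x \<noteq> 0" for x
  proof -
    let ?s = "x \<bullet> x"
    have s: "0 < ?s" using x by simp
    have "(\<lambda>n. indicator M x * H n x) \<longlonglongrightarrow> indicator M x * (norm x powr k *
        ((?s + 0) powr (- 1 / 2) * (1 + 0 * ?s) powr (- a / 2)) * (0 / (?s + 0) + a / (1 + 0 * ?s)))"
      unfolding H_def q_def using s by (intro tendsto_intros e0) auto
    moreover have "norm x powr k * ?s powr (- 1 / 2) = norm x powr (k - 1)"
      by (simp only: norm_powr_eq[of x "- 1", symmetric] powr_add[symmetric] diff_conv_add_uminus)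
    ultimately show ?thesis by (simp add: mult_ac)
  qed
  have "ennreal a * emeasure (mu (k - 1)) M = (\<integral>\<^sup>+x. ennreal (a * (indicator M x * norm x powr (k - 1))) \<partial>lebesgue)"
  proof -
    have meas: "(\<lambda>x. ennreal (norm x powr (k - 1)) * indicator M x) \<in> borel_measurable lebesgue"
      using M by (intro borel_measurable_times_ennreal borel_measurable_indicator) (auto intro!: measurable_completion)
    show ?thesis
      unfolding emeasure_mu_eq[OF M] using a
      by (subst nn_integral_cmult[OF meas, symmetric])
        (auto intro!: nn_integral_cong simp: ennreal_mult indicator_def)
  qed
  also have "\<dots> = (\<integral>\<^sup>+x. liminf (\<lambda>n. ennreal (indicator M x * H n x)) \<partial>lebesgue)"
  proof (rule nn_integral_cong_AE)
    have "AE x in lebesgue. x \<noteq> (0::real ^ 'n)"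
      using AE_lborel_singleton by (rule AE_completion)
    then show "AE x in lebesgue. ennreal (a * (indicator M x * norm x powr (k - 1)))
        = liminf (\<lambda>n. ennreal (indicator M x * H n x))"
    proof eventually_elim
      case (elim x)
      show ?case
        using lim_imp_Liminf[OF _ tendsto_ennrealI[OF Hlim[OF elim]]] by simp
    qed
  qed
  \<comment> \<open>Fatou's lemma applies because each \<open>H n\<close> is nonnegative; an
    integrable majorant is not at hand, as \<open>C\<close> grows with \<open>n\<close>.\<close>
  also have "\<dots> \<le> liminf (\<lambda>n. \<integral>\<^sup>+x. ennreal (indicator M x * H n x) \<partial>lebesgue)"
    by (rule nn_integral_liminf) measurable
  also have "\<dots> \<le> liminf (\<lambda>n. ennreal P)"
    by (intro Liminf_mono always_eventually allI Hle)
  finally show ?thesis by (simp add: a_def Liminf_const)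
qed

section \<open>Mass comparison with balls and the sharp constant\<close>

text \<open>Since \<open>M\<close> and the ball have equal \<open>mu l\<close>-measure, subtracting
  \<open>R powr (p - l)\<close> times the \<open>mu l\<close> density leaves the difference of their
  \<open>mu p\<close>-measures unchanged. The resulting integrand \<open>f\<close> is nonnegative:
  its first factor changes sign at radius \<open>R\<close>, just where membership in the ball
  does.\<close>

lemma bathtub_ball:
  fixes l p R :: real and M :: "(real ^ 'n) set"
  assumes l: "l + real CARD('n) > 0" and lp: "l \<le> p" and R: "R > 0" and M: "M \<in> sets lebesgue"
    and eq: "emeasure (mu l) M = emeasure (mu l) (ball (0::real ^ 'n) R)"
  shows "emeasure (mu p) (ball (0::real ^ 'n) R) \<le> emeasure (mu p) M"
    and "l < p \<Longrightarrow> emeasure (mu p) M \<le> emeasure (mu p) (ball (0::real ^ 'n) R)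
      \<Longrightarrow> sym_diff M (ball 0 R) \<in> null_sets lebesgue"
proof -
  let ?B = "ball (0::real ^ 'n) R"
  have B: "?B \<in> sets lebesgue" by simp
  have finB: "emeasure (mu q) ?B < \<infinity>" if "l \<le> q" for q
    using emeasure_mu_ball[of q R, where 'n='n] l R that by simp
  have finM: "emeasure (mu l) M < \<infinity>"
    using finB eq by simp
  define f where "f x = (norm x powr p - R powr (p - l) * norm x powr l) * (indicator M x - indicator ?B x)"
    for x :: "real ^ 'n"
  have fac: "norm x powr p - R powr (p - l) * norm x powr l = norm x powr l * (norm x powr (p - l) - R powr (p - l))"
    for x :: "real ^ 'n"
    by (simp add: algebra_simps powr_add[symmetric])
  have f0: "0 \<le> f x" for x
  proof (cases "x \<in> ?B")
    case True
    then have "norm x powr (p - l) \<le> R powr (p - l)"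
      using lp by (intro powr_mono2) auto
    then have "norm x powr l * (norm x powr (p - l) - R powr (p - l)) \<le> 0"
      by (intro mult_nonneg_nonpos) auto
    then show ?thesis using True by (auto simp: f_def fac indicator_def)
  next
    case False
    then have "R powr (p - l) \<le> norm x powr (p - l)"
      using lp R by (intro powr_mono2) auto
    then have "0 \<le> norm x powr l * (norm x powr (p - l) - R powr (p - l))"
      by (intro mult_nonneg_nonneg) auto
    then show ?thesis using False by (auto simp: f_def fac indicator_def)
  qed
  have int: "integrable lebesgue f \<and> (\<integral>x. f x \<partial>lebesgue) = measure (mu p) M - measure (mu p) ?B"
    if "emeasure (mu p) M < \<infinity>"
  proof -
    note i = integrable_mu_density[OF M that] integrable_mu_density[OF B finB[OF lp]]
      integrable_mu_density[OF M finM] integrable_mu_density[OF B finB[OF order_refl]]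
    have f: "f = (\<lambda>x. (indicator M x * norm x powr p - indicator ?B x * norm x powr p)
        - R powr (p - l) * (indicator M x * norm x powr l - indicator ?B x * norm x powr l))"
      by (auto simp: f_def algebra_simps)
    have "measure (mu l) M = measure (mu l) ?B"
      using eq by (simp add: measure_def)
    then show ?thesis
      unfolding f using i by simp
  qed
  show le: "emeasure (mu p) ?B \<le> emeasure (mu p) M"
  proof (cases "emeasure (mu p) M < \<infinity>")
    case True
    have "0 \<le> (\<integral>x. f x \<partial>lebesgue)" using f0 by simp
    then have "measure (mu p) ?B \<le> measure (mu p) M" using int[OF True] by simp
    then show ?thesis
      using True finB[OF lp] by (simp add: emeasure_eq_ennreal_measure)
  qed (simp add: not_less top_unique)
  assume "l < p" and "emeasure (mu p) M \<le> emeasure (mu p) ?B"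
  then have e: "emeasure (mu p) M = emeasure (mu p) ?B" using le by simp
  then have "emeasure (mu p) M < \<infinity>" using finB[OF lp] by simp
  from int[OF this] e have "integrable lebesgue f" "(\<integral>x. f x \<partial>lebesgue) = 0"
    by (auto simp: measure_def)
  then have "AE x in lebesgue. f x = 0"
    using integral_nonneg_eq_0_iff_AE[of lebesgue f] f0 by simp
  moreover have "AE x in lebesgue. x \<noteq> (0::real ^ 'n)"
    using AE_lborel_singleton by (rule AE_completion)
  moreover have "AE x in lebesgue. x \<notin> sphere (0::real ^ 'n) R"
    by (rule AE_not_in) (simp add: negligible_iff_null_sets[symmetric] negligible_sphere)
  \<comment> \<open>For \<open>l < p\<close> the first factor of \<open>f\<close> vanishes only at
    the origin and on the sphere of radius \<open>R\<close>, both null; elsewhere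
    \<open>f x = 0\<close> forces the indicators to agree.\<close>
  ultimately have "AE x in lebesgue. x \<notin> sym_diff M ?B"
  proof eventually_elim
    case (elim x)
    then have "norm x > 0" "norm x \<noteq> R" by auto
    then have "norm x powr (p - l) \<noteq> R powr (p - l)"
      using R \<open>l < p\<close> powr_less_mono2[of "p - l" "norm x" R] powr_less_mono2[of "p - l" R "norm x"]
      by (cases "norm x < R") auto
    then have "norm x powr p - R powr (p - l) * norm x powr l \<noteq> 0"
      unfolding fac using \<open>norm x > 0\<close> by simp
    with elim show ?case by (auto simp: f_def indicator_def split: if_splits)
  qed
  moreover have "sym_diff M ?B \<in> sets lebesgue"
    by (intro sets.Un sets.Diff M B)
  ultimately show "sym_diff M ?B \<in> null_sets lebesgue"
    by (simp add: AE_iff_null_sets)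
qed

text \<open>Scale invariance: the left side, which is \<open>k + N - 1\<close> times the
  \<open>mu (k - 1)\<close>-measure of the ball of radius \<open>R\<close>, and the power of its
  \<open>mu l\<close>-measure \<open>m\<close> have the same degree in \<open>R\<close>. The powers
  of \<open>N * omega\<close> match because \<open>(b - a) / b + a / b = 1\<close>.\<close>

lemma iso_const_rad_eq:
  fixes k l R :: real
  assumes l: "l + real CARD('n::finite) > 0" and R: "R > 0"
    and m: "m = CARD('n) * omega TYPE('n) * R powr (l + CARD('n)) / (l + CARD('n))"
  shows "CARD('n) * omega TYPE('n) * R powr (k + CARD('n) - 1)
    = iso_const_rad TYPE('n) k l * m powr ((k + CARD('n) - 1) / (l + CARD('n)))"
proof -
  define c where "c = CARD('n) * omega TYPE('n)"
  define b where "b = l + CARD('n)"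
  define a where "a = k + CARD('n) - 1"
  have c: "c > 0" unfolding c_def using omega_pos[where 'n='n] by simp
  have b: "b > 0" using l by (simp add: b_def)
  have m': "m = c * R powr b / b" using m by (simp add: c_def b_def)
  have "m powr (a / b) = c powr (a / b) * R powr a / b powr (a / b)"
    unfolding m' using c b R by (simp add: powr_divide powr_mult powr_powr)
  moreover have "iso_const_rad TYPE('n) k l = c powr ((b - a) / b) * b powr (a / b)"
    by (simp add: iso_const_rad_def a_def b_def c_def algebra_simps)
  moreover have "c powr ((b - a) / b) * c powr (a / b) = c"
    using b c by (simp add: powr_add[symmetric] add_divide_distrib[symmetric])
  ultimately have "iso_const_rad TYPE('n) k l * m powr (a / b) = c * R powr a"
    using b by simp
  then show ?thesis by (simp add: a_def b_def c_def)
qed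

section \<open>Comparison with the ball of equal measure, and rigidity\<close>

theorem theorem5p1:
  fixes k l :: real
  assumes "k + real CARD('n::finite) - 1 > 0"
    and "l + real CARD('n) > 0"
    and "l + 1 \<le> k"
  shows "iso_const TYPE('n) k l = ereal (iso_const_rad TYPE('n) k l) \<and>
    (l + 1 < k \<longrightarrow>
      (\<forall>M :: (real ^ 'n) set.
         admissible l M \<and> isoperimetric_ratio k l M = ereal (iso_const_rad TYPE('n) k l) \<longrightarrow>
         (\<exists>R>0. sym_diff M (ball 0 R) \<in> null_sets lebesgue)))"
proof -
  define a where "a = k + CARD('n) - 1"
  define b where "b = l + CARD('n)"
  define c where "c = CARD('n) * omega TYPE('n)"
  let ?C = "iso_const_rad TYPE('n) k l"
  have a: "a > 0" and b: "b > 0" and c: "c > 0"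
    using assms omega_pos[where 'n='n] by (auto simp: a_def b_def c_def)
  have ball: "emeasure (mu l) (ball (0::real ^ 'n) R) = ennreal (c * R powr b / b)"
    "ennreal a * emeasure (mu (k - 1)) (ball (0::real ^ 'n) R) = ennreal (c * R powr a)" if "R > 0" for R
  proof -
    show "emeasure (mu l) (ball (0::real ^ 'n) R) = ennreal (c * R powr b / b)"
      using emeasure_mu_ball[OF assms(2) that] by (simp add: b_def c_def)
    have "emeasure (mu (k - 1)) (ball (0::real ^ 'n) R) = ennreal (c * R powr a / a)"
      using emeasure_mu_ball[of "k - 1" R, where 'n='n] assms that by (simp add: a_def c_def algebra_simps)
    then show "ennreal a * emeasure (mu (k - 1)) (ball (0::real ^ 'n) R) = ennreal (c * R powr a)"
      using a c by (simp add: ennreal_mult[symmetric])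
  qed
  have const: "c * R powr a = ?C * (c * R powr b / b) powr (a / b)" if "R > 0" for R
    using iso_const_rad_eq[OF assms(2) that refl, of k] by (simp add: a_def b_def c_def)
  have key: "\<exists>R>0. measure (mu l) M = c * R powr b / b \<and> ereal (c * R powr a) \<le> perimeter k M
      \<and> (l + 1 < k \<longrightarrow> perimeter k M = ereal (c * R powr a) \<longrightarrow> sym_diff M (ball 0 R) \<in> null_sets lebesgue)"
    if adm: "admissible l M" for M :: "(real ^ 'n) set"
  proof -
    have M: "M \<in> sets lebesgue" and pos: "0 < emeasure (mu l) M" and fin: "emeasure (mu l) M < \<infinity>"
      using adm by (auto simp: admissible_def)
    define m where "m = measure (mu l) M"
    have em: "emeasure (mu l) M = ennreal m"
      using fin by (simp add: m_def emeasure_eq_ennreal_measure)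
    then have m: "m > 0" using pos by simp
    \<comment> \<open>The radius at which the centred ball has \<open>mu l\<close>-measure
      \<open>m\<close>.\<close>
    define R where "R = (m * b / c) powr (1 / b)"
    have R: "R > 0" using m b c by (simp add: R_def)
    have mR: "m = c * R powr b / b"
      using m b c by (simp add: R_def powr_powr)
    have eq: "emeasure (mu l) M = emeasure (mu l) (ball (0::real ^ 'n) R)"
      using ball(1)[OF R] em mR by simp
    have lk: "l \<le> k - 1" using assms(3) by simp
    have below: "ennreal a * emeasure (mu (k - 1)) M \<le> ennreal P" if "perimeter k M \<le> ereal P" for P
      using weighted_measure_le_perimeter[OF assms M fin that] by (simp add: a_def)
    have "ereal (c * R powr a) \<le> perimeter k M"
    \<comment> \<open>Testing against real upper bounds \<open>P\<close> disposes of infinite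
      perimeter, for which there is nothing to show.\<close>
    proof (rule ereal_le_real)
      fix P assume "perimeter k M \<le> ereal P"
      have "ennreal (c * R powr a) \<le> ennreal a * emeasure (mu (k - 1)) M"
        unfolding ball(2)[OF R, symmetric]
        by (intro mult_left_mono bathtub_ball(1)[OF assms(2) lk R M eq]) auto
      also note below[OF \<open>perimeter k M \<le> ereal P\<close>]
      finally show "ereal (c * R powr a) \<le> ereal P"
        \<comment> \<open>Positivity of the left side excludes a negative \<open>P\<close> that
          \<open>ennreal\<close> would have sent to 0.\<close>
        using mult_pos_pos[OF c, of "R powr a"] R unfolding ennreal_le_iff2 ereal_less_eq by auto
    qed
    moreover have "sym_diff M (ball 0 R) \<in> null_sets lebesgue"
      if "l + 1 < k" "perimeter k M = ereal (c * R powr a)"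
    proof (rule bathtub_ball(2)[OF assms(2) lk R M eq])
      have "ennreal a * emeasure (mu (k - 1)) M \<le> ennreal a * emeasure (mu (k - 1)) (ball (0::real ^ 'n) R)"
        unfolding ball(2)[OF R] using that(2) by (intro below) simp
      then show "emeasure (mu (k - 1)) M \<le> emeasure (mu (k - 1)) (ball (0::real ^ 'n) R)"
        using a by (subst (asm) ennreal_mult_le_mult_iff) auto
    qed (use that in simp)
    ultimately show ?thesis
      using R mR by (auto simp: m_def)
  qed
  have lower: "ereal ?C \<le> isoperimetric_ratio k l M" if adm: "admissible l M" for M :: "(real ^ 'n) set"
  proof -
    obtain R where R: "R > 0" "measure (mu l) M = c * R powr b / b" "ereal (c * R powr a) \<le> perimeter k M"
      using key[OF adm] by blast
    have m: "0 < measure (mu l) M powr (a / b)"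
      using R b c by simp
    have "ereal ?C = ereal (c * R powr a) / ereal (measure (mu l) M powr (a / b))"
      using m const[OF R(1)] unfolding R(2) by simp
    also have "\<dots> \<le> perimeter k M / ereal (measure (mu l) M powr (a / b))"
      using R(3) m by (intro ereal_divide_right_mono) auto
    finally show ?thesis by (simp add: isoperimetric_ratio_def a_def b_def)
  qed
  have adm1: "admissible l (ball (0::real ^ 'n) 1)"
    using ball(1)[of 1] b c by (auto simp: admissible_def)
  \<comment> \<open>One competitor attaining the lower bound settles the infimum, so the perimeter
    is estimated for radius 1 only.\<close>
  have "isoperimetric_ratio k l (ball (0::real ^ 'n) 1) \<le> ereal ?C"
  proof -
    have m1: "measure (mu l) (ball (0::real ^ 'n) 1) = c / b"
      using ball(1)[of 1] b c by (simp add: measure_def)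
    have "isoperimetric_ratio k l (ball (0::real ^ 'n) 1) \<le> ereal c / ereal ((c / b) powr (a / b))"
      unfolding isoperimetric_ratio_def m1 a_def[symmetric] b_def[symmetric]
      using perimeter_ball_le[OF assms(1)] b c by (intro ereal_divide_right_mono) (auto simp: c_def)
    also have "\<dots> = ereal ?C"
    proof -
      have "0 < (c / b) powr (a / b)" using b c by simp
      then show ?thesis using const[of 1] by (simp add: divide_eq_eq)
    qed
    finally show ?thesis .
  qed
  then have "iso_const TYPE('n) k l = ereal ?C"
    unfolding iso_const_def using lower adm1
    by (intro antisym INF_greatest) (auto intro: INF_lower2)
  moreover have "\<exists>R>0. sym_diff M (ball 0 R) \<in> null_sets lebesgue"
    if lk: "l + 1 < k" and adm: "admissible l M" and eq: "isoperimetric_ratio k l M = ereal ?C"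
    for M :: "(real ^ 'n) set"
  proof -
    obtain R where R: "R > 0" "measure (mu l) M = c * R powr b / b"
      and nul: "perimeter k M = ereal (c * R powr a) \<Longrightarrow> sym_diff M (ball 0 R) \<in> null_sets lebesgue"
      using key[OF adm] lk by blast
    have m: "0 < measure (mu l) M powr (a / b)"
      using R b c by simp
    have "perimeter k M / ereal (measure (mu l) M powr (a / b)) = ereal ?C"
      using eq by (simp add: isoperimetric_ratio_def a_def b_def)
    \<comment> \<open>The denominator is a positive real, so a finite ratio excludes an infinite
      perimeter.\<close>
    then have "perimeter k M = ereal (?C * measure (mu l) M powr (a / b))"
      using m by (cases "perimeter k M") (auto simp: field_simps)
    then show ?thesis
      using nul R const[OF R(1)] by auto
  qed
  ultimately show ?thesis by blast
qed

end
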